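(* Let $\mathfrak h$ be the 3-dimensional Heisenberg Lie algebra over a field $\mathbb K$ of characteristic zero, and let $H_E^{\bullet,\bullet}(\mathfrak h)=\bigoplus_{p+q\text{ even}}H^p(\mathfrak h,\bigwedge^q\mathfrak h)$ with its decomposition into the ten irreducible $\mathrm{SL}(2,\mathbb K)$-submodules $H_k^{p,q}$ and the $\mathrm{SL}(2,\mathbb K)$-isomorphisms $\tau_k^{p,q}:V_k\to H_k^{p,q}$ described in the context. Then the $\mathrm{SL}(2,\mathbb K)$-table of the Poisson bracket $\{-,-\}$ on $H_E^{\bullet,\bullet}(\mathfrak h)$ is $$\begin{array}{c||ccccc|ccccc} \{-,-\} & H_{0}^{0,0} & H_{0}^{1,1} & H_{2}^{1,1} & H_{1}^{2,0} & H_{1}^{0,2} & H_{0}^{2,2} & H_{2}^{2,2} & H_{1}^{3,1} & H_{1}^{1,3} & H_{0}^{3,3}\\ \hline H_{0}^{0,0} &0&0&0&0&0&0&0&0&0&0\\ H_{0}^{1,1} &0&0&0& 3H_{1}^{2,0} & -3H_{1}^{0,2} &0&0& 3H_{1}^{3,1} & -3H_{1}^{1,3}&0\\ H_{2}^{1,1} &0&0& -H_{2}^{1,1} & -H_{1}^{2,0} & -H_{1}^{0,2} &0& -H_{2}^{2,2} & -H_{1}^{3,1} & -H_{1}^{1,3}&0\\ H_{1}^{2,0} &0& -3H_{1}^{2,0} & H_{1}^{2,0} &0& \frac12H_{2}^{1,1}-\frac12H_{0}^{1,1} & H_{1}^{3,1} & H_{1}^{3,1} &0& -\frac12H_{2}^{2,2}-\frac32H_{0}^{2,2}&0\\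 H_{1}^{0,2} &0& 3H_{1}^{0,2} & H_{1}^{0,2} & -\frac12H_{2}^{1,1}-\frac12H_{0}^{1,1} &0& H_{1}^{1,3} & -H_{1}^{1,3} & -\frac12H_{2}^{2,2}+\frac32H_{0}^{2,2}&0&0\\ H_{0}^{2,2} &0&0&0& -H_{1}^{3,1} & -H_{1}^{1,3}&0&0&0&0&0\\ H_{2}^{2,2} &0&0& -H_{2}^{2,2} & -H_{1}^{3,1} & H_{1}^{1,3}&0&0&0&0&0\\ H_{1}^{3,1} &0& -3H_{1}^{3,1} & H_{1}^{3,1} &0& \frac12H_{2}^{2,2}+\frac32H_{0}^{2,2}&0&0&0&0&0\\ H_{1}^{1,3} &0& 3H_{1}^{1,3} & H_{1}^{1,3} & \frac12H_{2}^{2,2}-\frac32H_{0}^{2,2}&0&0&0&0&0&0\\ H_{0}^{3,3} &0&0&0&0&0&0&0&0&0&0 \end{array}$$ This means: if the entry in row $H_{a}^{p_1,q_1}$ and column $H_{b}^{p_2,q_2}$ is $\sum_{k} c_k\,H_{k}^{p,q}$, with $(p,q)=(p_1+p_2-1,q_1+q_2-1)$, then for all $v\in V_a$, $w\in V_b$, $$\big\{\tau_a^{p_1,q_1}(v),\tau_b^{p_2,q_2}(w)\big\}=\sum_k c_k\,\tau_k^{p,q}\big(m^{a,b,k}(v\otimes w)\big),$$ and the bracket is zero if the entry is $0$.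
   Context: $\mathfrak h$ has basis $x_1,x_{-1},h_0$ with only nonzero bracket $[x_1,x_{-1}]=h_0$ (up to skew-symmetry). The dual basis of $\mathfrak h^*$ is $x^{-1},x^{1},h^0$, with $x^{-1}(x_1)=1$, $x^{1}(x_{-1})=1$, $h^0(h_0)=1$ and all other pairings zero. $\mathrm{SL}(2,\mathbb K)$ acts on $\mathfrak h$ by automorphisms: $h_0$ is fixed and $\mathrm{span}\{x_1,x_{-1}\}$ is the canonical representation ($x_1\leftrightarrow(1,0)$, $x_{-1}\leftrightarrow(0,1)$). If $F$ is the lowering element of the standard basis $\{E,H,F\}$ of $\mathfrak{sl}(2,\mathbb K)$, then $F.x_1=x_{-1}$, $F.x^1=-x^{-1}$. Let $C^{p,q}=\bigwedge^p\mathfrak h^*\otimes\bigwedge^q\mathfrak h$, with product $(\phi\otimes v)\vee(\psi\otimes w)=(-1)^{p_2q_1}\,\phi\wedge\psi\otimes v\wedge w$ for $\phi\otimes v\in C^{p_1,q_1}$, $\psi\otimes w\in C^{p_2,q_2}$. $C^{\bullet,\bullet}$ is a Poisson superalgebra (parity of $C^{p,q}$ is $p+q$) with super-bracket $\{-,-\}:C^{p_1,q_1}\times C^{p_2,q_2}\to C^{p_1+p_2-1,q_1+q_2-1}$ determined by: $\{\mathfrak h,\mathfrak h\}=\{\mathfrak h^*,\mathfrak h^*\}=0$; $\{\phi,v\}=\{v,\phi\}=\phi(v)$ for $\phi\in\mathfrak h^*$, $v\in\mathfrak h$; $\{a,b\}=-(-1)^{(p_1+q_1)(p_2+q_2)}\{b,a\}$;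 and $\{a\vee b,c\}=a\vee\{b,c\}+(-1)^{(p_1+q_1)(p_2+q_2)}b\vee\{a,c\}$, for $a\in C^{p_1,q_1}$, $b\in C^{p_2,q_2}$. Let $\mu=x^{-1}\wedge x^1\otimes h_0\in C^{2,1}$ be the Lie bracket of $\mathfrak h$; the Chevalley–Eilenberg differential is $d=\{\mu,-\}:C^{p,q}\to C^{p+1,q}$, and $H^{p,q}=H^p(\mathfrak h,\bigwedge^q\mathfrak h)$ is its cohomology. The product $\vee$ and the bracket descend to cohomology; the even part $H_E^{\bullet,\bullet}(\mathfrak h)=\bigoplus_{p+q\text{ even}}H^{p,q}$ is a Poisson algebra with bracket $\{-,-\}$. Irreducible $\mathrm{SL}(2,\mathbb K)$-modules used: $V_0=\mathbb K$ (trivial), $V_1=\mathbb K^2$ (canonical), $V_2=\mathfrak{sl}(2,\mathbb K)$ (adjoint), with highest weight vectors $\bar v$ equal to $1$, $(1,0)$, $\left(\begin{smallmatrix}0&1\\0&0\end{smallmatrix}\right)$ respectively. Chosen equivariant maps $m^{i,j,k}:V_i\otimes V_j\to V_k$: $m^{0,i,i}(c\otimes v)=m^{i,0,i}(v\otimes c)=cv$; $m^{1,1,0}((x_1,x_2)\otimes(y_1,y_2))=x_1y_2-x_2y_1$; $m^{1,1,2}((x_1,x_2)\otimes(y_1,y_2))=\left(\begin{smallmatrix}x_1y_2+x_2y_1&-2x_1y_1\\2x_2y_2&-x_1y_2-x_2y_1\end{smallmatrix}\right)$; $m^{2,1,1}(A\otimes(x_1,x_2))=m^{1,2,1}((x_1,x_2)\otimes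 A)=(x_1,x_2)A^t$; $m^{2,2,0}(A\otimes B)=\mathrm{tr}(AB)$; $m^{2,2,2}(A\otimes B)=AB-BA$. $H_E^{\bullet,\bullet}(\mathfrak h)$ is the direct sum of irreducible submodules $H_k^{p,q}\subset H^{p,q}$, $H_k^{p,q}\simeq V_k$, generated by the classes of the following highest weight vectors (wedge symbols omitted): $H_0^{0,0}$: $1\otimes1$; $H_1^{2,0}$: $x^1h^0\otimes1$; $H_0^{1,1}$: $x^1\otimes x_{-1}+x^{-1}\otimes x_1+2h^0\otimes h_0$; $H_2^{1,1}$: $x^1\otimes x_1$; $H_1^{3,1}$: $x^{-1}x^1h^0\otimes x_1$; $H_1^{0,2}$: $1\otimes x_1h_0$; $H_0^{2,2}$: $x^{-1}x^1\otimes x_1x_{-1}$; $H_2^{2,2}$: $x^1h^0\otimes x_1h_0$; $H_1^{1,3}$: $x^1\otimes x_1x_{-1}h_0$; $H_0^{3,3}$: $x^{-1}x^1h^0\otimes x_1x_{-1}h_0$. The map $\tau_k^{p,q}:V_k\to H_k^{p,q}$ is the unique $\mathrm{SL}(2,\mathbb K)$-isomorphism sending the chosen highest weight vector $\bar v\in V_k$ to the class of the listed highest weight vector. *)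

theory Defs
  imports "HOL-Analysis.Analysis"
begin

text \<open>
  If \<open>'i\<close> is a finite linearly ordered type, then \<open>('k, 'i set) vec\<close> is the exterior algebra of
  the vector space with basis \<open>(e\<^sub>i)\<close>: the coordinate at \<open>S = {i\<^sub>1 < \<dots> < i\<^sub>r}\<close> is the coefficient of
  \<open>e\<^sub>S = e\<^sub>i\<^sub>1 \<and> \<dots> \<and> e\<^sub>i\<^sub>r\<close>.  Then \<open>e\<^sub>S \<and> e\<^sub>T\<close> is zero unless \<open>S\<close>, \<open>T\<close> are disjoint, and equals
  \<open>\<plusminus>e\<^sub>S\<^sub>\<union>\<^sub>T\<close> otherwise, the sign being that of the permutation sorting the concatenation.  The unit is
  \<open>e\<^bsub>{}\<^esub>\<close>; the pointwise product and the constant vector \<open>1\<close> of the library type \<open>vec\<close> play no role.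
\<close>

abbreviation bas :: "'j::finite \<Rightarrow> ('k::field, 'j) vec" where
  "bas j \<equiv> axis j 1"

definition shuffle_sign :: "'i::linorder set \<Rightarrow> 'i set \<Rightarrow> 'k::field" where
  "shuffle_sign S T = (-1) ^ card {(s, t). s \<in> S \<and> t \<in> T \<and> t < s}"

definition wedge ::
  "('k::field, 'i::{finite,linorder} set) vec \<Rightarrow> ('k, 'i set) vec \<Rightarrow> ('k, 'i set) vec"
  where "wedge a b = (\<chi> U. \<Sum>S\<in>Pow U. shuffle_sign S (U - S) * a $ S * b $ (U - S))"

definition ext_incl :: "('k::field, 'i::finite) vec \<Rightarrow> ('k, 'i set) vec" where
  "ext_incl v = (\<Sum>i\<in>UNIV. v $ i *s bas {i})"

text \<open>The algebra endomorphism of the exterior algebra induced by an endomorphism \<open>f\<close>: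
  \<open>e\<^sub>i\<^sub>1 \<and> \<dots> \<and> e\<^sub>i\<^sub>r \<mapsto> f e\<^sub>i\<^sub>1 \<and> \<dots> \<and> f e\<^sub>i\<^sub>r\<close>.\<close>

definition ext_map ::
  "(('k::field, 'i::{finite,linorder}) vec \<Rightarrow> ('k, 'i) vec) \<Rightarrow> ('k, 'i set) vec \<Rightarrow> ('k, 'i set) vec"
  where "ext_map f a = (\<Sum>S\<in>UNIV. a $ S *s
    foldr wedge (map (\<lambda>i. ext_incl (f (bas i))) (sorted_list_of_set S)) (bas {}))"

text \<open>\<open>Xp\<close>, \<open>Xm\<close>, \<open>H0\<close> index the basis \<open>x\<^sub>1\<close>, \<open>x\<^sub>-\<^sub>1\<close>, \<open>h\<^sub>0\<close> of the Heisenberg algebra; elements of the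
  dual space are given by their coordinates in the dual basis.  Beware of the superscripts: the
  functional dual to \<open>x\<^sub>1\<close> is called \<open>x\<^sup>-\<^sup>1\<close> and the one dual to \<open>x\<^sub>-\<^sub>1\<close> is called \<open>x\<^sup>1\<close>.\<close>

datatype hb = Xp | Xm | H0

lemma UNIV_hb: "(UNIV :: hb set) = {Xp, Xm, H0}"
  using hb.exhaust by auto

instance hb :: finite
  by standard (simp add: UNIV_hb)

instantiation hb :: linorder
begin

fun rank_hb :: "hb \<Rightarrow> nat" where
  "rank_hb Xp = 0" | "rank_hb Xm = 1" | "rank_hb H0 = 2"

definition less_eq_hb :: "hb \<Rightarrow> hb \<Rightarrow> bool" where
  "less_eq_hb a b \<longleftrightarrow> rank_hb a \<le> rank_hb b"

definition less_hb :: "hb \<Rightarrow> hb \<Rightarrow> bool" where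
  "less_hb a b \<longleftrightarrow> rank_hb a < rank_hb b"

lemma rank_hb_inj: "rank_hb a = rank_hb b \<Longrightarrow> a = b"
  by (cases a; cases b) simp_all

instance
  by standard (auto simp: less_eq_hb_def less_hb_def intro: rank_hb_inj)

end

type_synonym 'k heis = "('k, hb) vec"
type_synonym 'k dual = "('k, hb) vec"
type_synonym 'k ext = "('k, hb set) vec"

definition pairing :: "'k::field dual \<Rightarrow> 'k heis \<Rightarrow> 'k" where
  "pairing \<phi> v = (\<Sum>b\<in>UNIV. \<phi> $ b * v $ b)"

text \<open>The coordinate at \<open>(S, T)\<close> belongs to the basis vector \<open>e\<^sub>S \<otimes> e\<^sub>T\<close> of
  \<open>\<And>h\<^sup>* \<otimes> \<And>h\<close>: the first index refers to the dual, the second to the Lie algebra itself.\<close>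

type_synonym 'k cochain = "('k, hb set \<times> hb set) vec"

definition tensor :: "'k::field ext \<Rightarrow> 'k ext \<Rightarrow> 'k cochain" where
  "tensor \<phi> v = (\<chi> x. \<phi> $ fst x * v $ snd x)"

text \<open>Integer bidegrees, so that the component of a negative bidegree is zero.\<close>

definition cochains :: "int \<Rightarrow> int \<Rightarrow> 'k::field cochain set" where
  "cochains p q = {a. \<forall>S T. a $ (S, T) \<noteq> 0 \<longrightarrow> int (card S) = p \<and> int (card T) = q}"

definition vee :: "'k::field cochain \<Rightarrow> 'k cochain \<Rightarrow> 'k cochain" where
  "vee a b = (\<Sum>(S1, T1)\<in>UNIV. \<Sum>(S2, T2)\<in>UNIV.
     (a $ (S1, T1) * b $ (S2, T2) * (-1) ^ (card S2 * card T1)) *s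
       tensor (wedge (bas S1) (bas S2)) (wedge (bas T1) (bas T2)))"

definition of_heis :: "'k::field heis \<Rightarrow> 'k cochain" where
  "of_heis v = tensor (bas {}) (ext_incl v)"

definition of_dual :: "'k::field dual \<Rightarrow> 'k cochain" where
  "of_dual \<phi> = tensor (ext_incl \<phi>) (bas {})"

definition is_super_bracket ::
  "('k::field cochain \<Rightarrow> 'k cochain \<Rightarrow> 'k cochain) \<Rightarrow> bool" where
  "is_super_bracket br \<longleftrightarrow>
     (\<forall>a. Vector_Spaces.linear (*s) (*s) (br a)) \<and>
     (\<forall>b. Vector_Spaces.linear (*s) (*s) (\<lambda>a. br a b)) \<and>
     (\<forall>(p1::nat) (q1::nat) (p2::nat) (q2::nat). \<forall>a\<in>cochains p1 q1. \<forall>b\<in>cochains p2 q2.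
        br a b \<in> cochains (int p1 + int p2 - 1) (int q1 + int q2 - 1)) \<and>
     (\<forall>v w. br (of_heis v) (of_heis w) = 0) \<and>
     (\<forall>\<phi> \<psi>. br (of_dual \<phi>) (of_dual \<psi>) = 0) \<and>
     (\<forall>\<phi> v. br (of_dual \<phi>) (of_heis v) = pairing \<phi> v *s bas ({}, {}) \<and>
            br (of_heis v) (of_dual \<phi>) = pairing \<phi> v *s bas ({}, {})) \<and>
     (\<forall>(p1::nat) (q1::nat) (p2::nat) (q2::nat). \<forall>a\<in>cochains p1 q1. \<forall>b\<in>cochains p2 q2.
        br a b = (- ((-1) ^ ((p1 + q1) * (p2 + q2)))) *s br b a) \<and>
     (\<forall>(p1::nat) (q1::nat) (p2::nat) (q2::nat). \<forall>a\<in>cochains p1 q1. \<forall>b\<in>cochains p2 q2. \<forall>c.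
        br (vee a b) c =
          vee a (br b c) + (-1) ^ ((p1 + q1) * (p2 + q2)) *s vee b (br a c))"

definition super_bracket :: "'k::field cochain \<Rightarrow> 'k cochain \<Rightarrow> 'k cochain" where
  "super_bracket = (THE br. is_super_bracket br)"

abbreviation "vec_x1 \<equiv> ext_incl (bas Xp)"
abbreviation "vec_xm1 \<equiv> ext_incl (bas Xm)"
abbreviation "vec_h0 \<equiv> ext_incl (bas H0)"
abbreviation "dual_x1 \<equiv> ext_incl (bas Xm)"  \<comment> \<open>\<open>x\<^sup>1\<close>, dual to \<open>x\<^sub>-\<^sub>1\<close>\<close>
abbreviation "dual_xm1 \<equiv> ext_incl (bas Xp)"  \<comment> \<open>\<open>x\<^sup>-\<^sup>1\<close>, dual to \<open>x\<^sub>1\<close>\<close>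
abbreviation "dual_h0 \<equiv> ext_incl (bas H0)"  \<comment> \<open>\<open>h\<^sup>0\<close>, dual to \<open>h\<^sub>0\<close>\<close>

definition mu :: "'k::field cochain" where
  "mu = tensor (wedge dual_xm1 dual_x1) vec_h0"

definition ce_diff :: "'k::field cochain \<Rightarrow> 'k cochain" where
  "ce_diff = super_bracket mu"

definition SL2 :: "('k::field ^ 2 ^ 2) set" where
  "SL2 = {g. det g = 1}"

definition heis_act :: "'k::field ^ 2 ^ 2 \<Rightarrow> 'k heis \<Rightarrow> 'k heis" where
  "heis_act g v = (v $ Xp * g $ 1 $ 1 + v $ Xm * g $ 1 $ 2) *s bas Xp
                + (v $ Xp * g $ 2 $ 1 + v $ Xm * g $ 2 $ 2) *s bas Xm
                + v $ H0 *s bas H0"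

text \<open>The contragredient action \<open>(g \<phi>)(v) = \<phi>(g\<inverse> v)\<close>.\<close>

definition dual_act :: "'k::field ^ 2 ^ 2 \<Rightarrow> 'k dual \<Rightarrow> 'k dual" where
  "dual_act g \<phi> = (\<chi> b. pairing \<phi> (heis_act (matrix_inv g) (bas b)))"

definition act :: "'k::field ^ 2 ^ 2 \<Rightarrow> 'k cochain \<Rightarrow> 'k cochain" where
  "act g a = (\<Sum>(S, T)\<in>UNIV. a $ (S, T) *s
     tensor (ext_map (dual_act g) (bas S)) (ext_map (heis_act g) (bas T)))"

text \<open>Cohomology classes are cosets of the coboundaries in the total complex.  The linear structure,
  the action and the bracket on classes are computed on arbitrary representatives.\<close>

type_synonym 'k coho = "'k cochain set"

definition cls :: "'k::field cochain \<Rightarrow> 'k coho" where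
  "cls a = {a + ce_diff b | b. True}"

definition rep :: "'k::field coho \<Rightarrow> 'k cochain" where
  "rep A = (SOME a. a \<in> A)"

definition cohomology :: "int \<Rightarrow> int \<Rightarrow> 'k::field coho set" where
  "cohomology p q = cls ` {a \<in> cochains p q. ce_diff a = 0}"

definition hadd :: "'k::field coho \<Rightarrow> 'k coho \<Rightarrow> 'k coho" where
  "hadd A B = cls (rep A + rep B)"

definition hscale :: "'k::field \<Rightarrow> 'k coho \<Rightarrow> 'k coho" where
  "hscale c A = cls (c *s rep A)"

definition hact :: "'k::field ^ 2 ^ 2 \<Rightarrow> 'k coho \<Rightarrow> 'k coho" where
  "hact g A = cls (act g (rep A))"

definition hbracket :: "'k::field coho \<Rightarrow> 'k coho \<Rightarrow> 'k coho" where
  "hbracket A B = cls (super_bracket (rep A) (rep B))"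

definition hsum :: "'k::field coho list \<Rightarrow> 'k coho" where
  "hsum As = foldr hadd As (cls 0)"

definition hsubmodule :: "'k::field coho set \<Rightarrow> bool" where
  "hsubmodule W \<longleftrightarrow> cls 0 \<in> W \<and> (\<forall>A\<in>W. \<forall>B\<in>W. hadd A B \<in> W) \<and>
     (\<forall>c. \<forall>A\<in>W. hscale c A \<in> W) \<and> (\<forall>g\<in>SL2. \<forall>A\<in>W. hact g A \<in> W)"

text \<open>To treat \<open>V\<^sub>0 = K\<close>, \<open>V\<^sub>1 = K\<^sup>2\<close>, \<open>V\<^sub>2 = sl(2, K)\<close> uniformly they are placed as the summands
  of \<open>K \<oplus> K\<^sup>2 \<oplus> gl(2, K)\<close>.\<close>

type_synonym 'k ambient = "'k \<times> ('k ^ 2) \<times> ('k ^ 2 ^ 2)"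

datatype irrep = I0 | I1 | I2

fun Vmod :: "irrep \<Rightarrow> 'k::field ambient set" where
  "Vmod I0 = {(c, 0, 0) | c. True}"
| "Vmod I1 = {(0, x, 0) | x. True}"
| "Vmod I2 = {(0, 0, A) | A. trace A = 0}"

fun hw :: "irrep \<Rightarrow> 'k::field ambient" where
  "hw I0 = (1, 0, 0)"
| "hw I1 = (0, vector [1, 0], 0)"
| "hw I2 = (0, 0, vector [vector [0, 1], vector [0, 0]])"

fun vscale :: "'k::field \<Rightarrow> 'k ambient \<Rightarrow> 'k ambient" where
  "vscale c (a, x, A) = (c * a, c *s x, \<chi> i j. c * A $ i $ j)"

fun vact :: "'k::field ^ 2 ^ 2 \<Rightarrow> 'k ambient \<Rightarrow> 'k ambient" where
  "vact g (a, x, A) = (a, g *v x, g ** A ** matrix_inv g)"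

text \<open>\<open>mmap i j k v w\<close> is \<open>m\<^sup>i\<^sup>,\<^sup>j\<^sup>,\<^sup>k(v \<otimes> w)\<close> for \<open>v \<in> V\<^sub>i\<close> and \<open>w \<in> V\<^sub>j\<close>; triples for which no map has
  been chosen do not occur and get the value 0.\<close>

fun mmap :: "irrep \<Rightarrow> irrep \<Rightarrow> irrep \<Rightarrow> 'k::field ambient \<Rightarrow> 'k ambient \<Rightarrow> 'k ambient" where
  "mmap I0 I0 I0 (c, _, _) w = vscale c w"
| "mmap I0 I1 I1 (c, _, _) w = vscale c w"
| "mmap I0 I2 I2 (c, _, _) w = vscale c w"
| "mmap I1 I0 I1 v (c, _, _) = vscale c v"
| "mmap I2 I0 I2 v (c, _, _) = vscale c v"
| "mmap I1 I1 I0 (_, x, _) (_, y, _) = (x $ 1 * y $ 2 - x $ 2 * y $ 1, 0, 0)"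
| "mmap I1 I1 I2 (_, x, _) (_, y, _) = (0, 0, vector
     [vector [x $ 1 * y $ 2 + x $ 2 * y $ 1, - 2 * x $ 1 * y $ 1],
      vector [2 * x $ 2 * y $ 2, - (x $ 1 * y $ 2) - x $ 2 * y $ 1]])"
| "mmap I2 I1 I1 (_, _, A) (_, x, _) = (0, x v* transpose A, 0)"
| "mmap I1 I2 I1 (_, x, _) (_, _, A) = (0, x v* transpose A, 0)"
| "mmap I2 I2 I0 (_, _, A) (_, _, B) = (trace (A ** B), 0, 0)"
| "mmap I2 I2 I2 (_, _, A) (_, _, B) = (0, 0, A ** B - B ** A)"
| "mmap _ _ _ _ _ = 0"

text \<open>The name \<open>Hk_pq\<close> stands for the component \<open>H\<^sub>k\<^sup>p\<^sup>,\<^sup>q\<close>.\<close>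

datatype comp = H0_00 | H0_11 | H2_11 | H1_20 | H1_02 | H0_22 | H2_22 | H1_31 | H1_13 | H0_33

fun wt :: "comp \<Rightarrow> irrep" where
  "wt H0_00 = I0" | "wt H0_11 = I0" | "wt H2_11 = I2" | "wt H1_20 = I1" | "wt H1_02 = I1"
| "wt H0_22 = I0" | "wt H2_22 = I2" | "wt H1_31 = I1" | "wt H1_13 = I1" | "wt H0_33 = I0"

fun pdeg :: "comp \<Rightarrow> int" where
  "pdeg H0_00 = 0" | "pdeg H0_11 = 1" | "pdeg H2_11 = 1" | "pdeg H1_20 = 2" | "pdeg H1_02 = 0"
| "pdeg H0_22 = 2" | "pdeg H2_22 = 2" | "pdeg H1_31 = 3" | "pdeg H1_13 = 1" | "pdeg H0_33 = 3"

fun qdeg :: "comp \<Rightarrow> int" where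
  "qdeg H0_00 = 0" | "qdeg H0_11 = 1" | "qdeg H2_11 = 1" | "qdeg H1_20 = 0" | "qdeg H1_02 = 2"
| "qdeg H0_22 = 2" | "qdeg H2_22 = 2" | "qdeg H1_31 = 1" | "qdeg H1_13 = 3" | "qdeg H0_33 = 3"

fun hwv :: "comp \<Rightarrow> 'k::field cochain" where
  "hwv H0_00 = tensor (bas {}) (bas {})"
| "hwv H1_20 = tensor (wedge dual_x1 dual_h0) (bas {})"
| "hwv H0_11 = tensor dual_x1 vec_xm1 + tensor dual_xm1 vec_x1 + 2 *s tensor dual_h0 vec_h0"
| "hwv H2_11 = tensor dual_x1 vec_x1"
| "hwv H1_31 = tensor (wedge dual_xm1 (wedge dual_x1 dual_h0)) vec_x1"
| "hwv H1_02 = tensor (bas {}) (wedge vec_x1 vec_h0)"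
| "hwv H0_22 = tensor (wedge dual_xm1 dual_x1) (wedge vec_x1 vec_xm1)"
| "hwv H2_22 = tensor (wedge dual_x1 dual_h0) (wedge vec_x1 vec_h0)"
| "hwv H1_13 = tensor dual_x1 (wedge vec_x1 (wedge vec_xm1 vec_h0))"
| "hwv H0_33 = tensor (wedge dual_xm1 (wedge dual_x1 dual_h0)) (wedge vec_x1 (wedge vec_xm1 vec_h0))"

definition Hcomp :: "comp \<Rightarrow> 'k::field coho set" where
  "Hcomp r = \<Inter> {W. W \<subseteq> cohomology (pdeg r) (qdeg r) \<and> hsubmodule W \<and> cls (hwv r) \<in> W}"

definition is_tau :: "comp \<Rightarrow> ('k::field ambient \<Rightarrow> 'k coho) \<Rightarrow> bool" where
  "is_tau r f \<longleftrightarrow>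
     bij_betw f (Vmod (wt r)) (Hcomp r) \<and>
     (\<forall>v\<in>Vmod (wt r). \<forall>w\<in>Vmod (wt r). f (v + w) = hadd (f v) (f w)) \<and>
     (\<forall>c. \<forall>v\<in>Vmod (wt r). f (vscale c v) = hscale c (f v)) \<and>
     (\<forall>g\<in>SL2. \<forall>v\<in>Vmod (wt r). f (vact g v) = hact g (f v)) \<and>
     f (hw (wt r)) = cls (hwv r)"

text \<open>Extensionality only fixes the irrelevant values outside \<open>V\<^sub>k\<close>, to make the map unique.\<close>

definition tau :: "comp \<Rightarrow> 'k::field ambient \<Rightarrow> 'k coho" where
  "tau r = (THE f. f \<in> extensional (Vmod (wt r)) \<and> is_tau r f)"

text \<open>The entry in row \<open>r\<close> and column \<open>s\<close>, as a list of coefficients and components; pairs that are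
  not listed have entry 0.\<close>

fun table :: "comp \<Rightarrow> comp \<Rightarrow> ('k::field \<times> comp) list" where
  "table H0_11 H1_20 = [(3, H1_20)]"
| "table H0_11 H1_02 = [(-3, H1_02)]"
| "table H0_11 H1_31 = [(3, H1_31)]"
| "table H0_11 H1_13 = [(-3, H1_13)]"
| "table H2_11 H2_11 = [(-1, H2_11)]"
| "table H2_11 H1_20 = [(-1, H1_20)]"
| "table H2_11 H1_02 = [(-1, H1_02)]"
| "table H2_11 H2_22 = [(-1, H2_22)]"
| "table H2_11 H1_31 = [(-1, H1_31)]"
| "table H2_11 H1_13 = [(-1, H1_13)]"
| "table H1_20 H0_11 = [(-3, H1_20)]"
| "table H1_20 H2_11 = [(1, H1_20)]"
| "table H1_20 H1_02 = [(1/2, H2_11), (-1/2, H0_11)]"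
| "table H1_20 H0_22 = [(1, H1_31)]"
| "table H1_20 H2_22 = [(1, H1_31)]"
| "table H1_20 H1_13 = [(-1/2, H2_22), (-3/2, H0_22)]"
| "table H1_02 H0_11 = [(3, H1_02)]"
| "table H1_02 H2_11 = [(1, H1_02)]"
| "table H1_02 H1_20 = [(-1/2, H2_11), (-1/2, H0_11)]"
| "table H1_02 H0_22 = [(1, H1_13)]"
| "table H1_02 H2_22 = [(-1, H1_13)]"
| "table H1_02 H1_31 = [(-1/2, H2_22), (3/2, H0_22)]"
| "table H0_22 H1_20 = [(-1, H1_31)]"
| "table H0_22 H1_02 = [(-1, H1_13)]"
| "table H2_22 H2_11 = [(-1, H2_22)]"
| "table H2_22 H1_20 = [(-1, H1_31)]"
| "table H2_22 H1_02 = [(1, H1_13)]"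
| "table H1_31 H0_11 = [(-3, H1_31)]"
| "table H1_31 H2_11 = [(1, H1_31)]"
| "table H1_31 H1_02 = [(1/2, H2_22), (3/2, H0_22)]"
| "table H1_13 H0_11 = [(3, H1_13)]"
| "table H1_13 H2_11 = [(1, H1_13)]"
| "table H1_13 H1_20 = [(1/2, H2_22), (-3/2, H0_22)]"
| "table _ _ = []"

end

theory Submission
  imports Defs
begin

text \<open>
  The space of cochains is the Grassmann algebra on six odd generators, the basis of \<open>h\<close> and its dual
  basis, and its super-bracket is the canonical one: \<open>{a, b}\<close> is the sum, over all generators, of the right
  derivative of \<open>a\<close> by the generator times the left derivative of \<open>b\<close> by the dual generator.  This
  expression (\<open>poisson\<close>) satisfies the axioms of the bracket, and no other operation does, because the
  Leibniz rule reduces all brackets to those of generators (\<open>super_bracket_eq\<close>).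

  The Lie bracket \<open>mu\<close> is odd, so \<open>d = {mu, -}\<close> is an odd derivation of the super-bracket; this is the
  part of the Jacobi identity that is needed (\<open>ham_poisson\<close>).  It implies that the bracket of a
  cocycle with a coboundary is a coboundary, hence that the bracket of two classes can be computed on
  any representatives (\<open>hbracket_cls\<close>).  Likewise \<open>d\<close> commutes with \<open>SL(2)\<close> (\<open>ce_diff_act\<close>), so \<open>SL(2)\<close>
  acts on classes through representatives.

  For each of the ten components, the highest weight vector already generates an irreducible module
  inside the cocycles, parametrized by an explicit equivariant map (\<open>lift\<close>), and this module contains
  no coboundary except zero (\<open>lift_exact_zero\<close>).  As the highest weight vector of the irreducible module
  generates it (\<open>Vmod_generated\<close>), the map \<open>tau\<close> is the passage to classes after \<open>lift\<close> (\<open>tau_eq\<close>).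

  The table is thereby reduced to identities between explicit cochains, bilinear in the two arguments
  (\<open>poisson_lift\<close>).  They hold exactly, except for four entries in which a multiple of the coboundary
  \<open>d(h\<^sup>0 \<otimes> x\<^sub>1 x\<^sub>-\<^sub>1)\<close> has to be subtracted.  The characteristic enters through the invertibility of \<open>2\<close>.
\<close>

section \<open>Linear maps on basis vectors\<close>

lemma bas_nth: "bas j $ i = (if i = j then 1 else 0)"
  by (simp add: axis_def)

lemma linearI:
  fixes f :: "('k::field, 'a::finite) vec \<Rightarrow> ('k, 'b::finite) vec"
  assumes "\<And>a b. f (a + b) = f a + f b" "\<And>c a. f (c *s a) = c *s f a"
  shows "Vector_Spaces.linear (*s) (*s) f"
  using assms by unfold_locales

lemma linear_eq_on_bas:
  fixes f g :: "('k::field, 'a::finite) vec \<Rightarrow> ('k, 'b::finite) vec"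
  assumes "Vector_Spaces.linear (*s) (*s) f" "Vector_Spaces.linear (*s) (*s) g"
    and "\<And>x. f (bas x) = g (bas x)"
  shows "f a = g a"
proof -
  interpret f: Vector_Spaces.linear "(*s)" "(*s)" f by fact
  interpret g: Vector_Spaces.linear "(*s)" "(*s)" g by fact
  have "f (\<Sum>x\<in>UNIV. a $ x *s bas x) = g (\<Sum>x\<in>UNIV. a $ x *s bas x)"
    by (simp add: f.sum g.sum f.scale g.scale assms(3))
  then show ?thesis by (simp add: basis_expansion)
qed

section \<open>Signs\<close>

lemma shuffle_sign_Un_left:
  fixes S S' T :: "'i::{finite,linorder} set"
  assumes "S \<inter> S' = {}"
  shows "shuffle_sign (S \<union> S') T = (shuffle_sign S T * shuffle_sign S' T :: 'k::field)"
proof -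
  have "{(s, t). s \<in> S \<union> S' \<and> t \<in> T \<and> t < s}
      = {(s, t). s \<in> S \<and> t \<in> T \<and> t < s} \<union> {(s, t). s \<in> S' \<and> t \<in> T \<and> t < s}"
    by auto
  moreover have "card (\<dots>) = card {(s, t). s \<in> S \<and> t \<in> T \<and> t < s} + card {(s, t). s \<in> S' \<and> t \<in> T \<and> t < s}"
    using assms by (intro card_Un_disjoint) auto
  ultimately show ?thesis
    by (simp add: shuffle_sign_def power_add)
qed

lemma shuffle_sign_Un_right:
  fixes S T T' :: "'i::{finite,linorder} set"
  assumes "T \<inter> T' = {}"
  shows "shuffle_sign S (T \<union> T') = (shuffle_sign S T * shuffle_sign S T' :: 'k::field)"
proof -
  have "{(s, t). s \<in> S \<and> t \<in> T \<union> T' \<and> t < s}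
      = {(s, t). s \<in> S \<and> t \<in> T \<and> t < s} \<union> {(s, t). s \<in> S \<and> t \<in> T' \<and> t < s}"
    by auto
  moreover have "card (\<dots>) = card {(s, t). s \<in> S \<and> t \<in> T \<and> t < s} + card {(s, t). s \<in> S \<and> t \<in> T' \<and> t < s}"
    using assms by (intro card_Un_disjoint) auto
  ultimately show ?thesis
    by (simp add: shuffle_sign_def power_add)
qed

lemma shuffle_sign_swap:
  fixes S T :: "'i::{finite,linorder} set"
  assumes "S \<inter> T = {}"
  shows "shuffle_sign S T * shuffle_sign T S = ((-1) ^ (card S * card T) :: 'k::field)"
proof -
  have "S \<times> T = {(s, t). s \<in> S \<and> t \<in> T \<and> t < s} \<union> prod.swap ` {(t, s). t \<in> T \<and> s \<in> S \<and> s < t}"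
    using assms by (force simp: image_iff)
  then have "card (S \<times> T) = card ({(s, t). s \<in> S \<and> t \<in> T \<and> t < s} \<union> prod.swap ` {(t, s). t \<in> T \<and> s \<in> S \<and> s < t})"
    by simp
  also have "\<dots> = card {(s, t). s \<in> S \<and> t \<in> T \<and> t < s} + card {(t, s). t \<in> T \<and> s \<in> S \<and> s < t}"
    by (subst card_Un_disjoint) (auto simp: card_image)
  finally show ?thesis
    by (simp add: shuffle_sign_def power_add[symmetric] card_cartesian_product)
qed

lemma wedge_bas:
  "wedge (bas S) (bas T) = (if S \<inter> T = {} then shuffle_sign S T *s bas (S \<union> T) else 0)"
proof -
  have "wedge (bas S) (bas T) $ U
      = (if S \<inter> T = {} then shuffle_sign S T *s bas (S \<union> T) else 0) $ U" for U
  proof -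
    have "wedge (bas S) (bas T) $ U
        = (\<Sum>A\<in>Pow U. if A = S then shuffle_sign S (U - S) * bas T $ (U - S) else 0)"
      unfolding wedge_def vec_lambda_beta by (intro sum.cong refl) (simp add: bas_nth)
    also have "\<dots> = (if S \<subseteq> U then shuffle_sign S (U - S) * bas T $ (U - S) else 0)"
      by simp
    also have "\<dots> = (if S \<inter> T = {} then shuffle_sign S T *s bas (S \<union> T) else 0) $ U"
    proof (cases "S \<subseteq> U \<and> U - S = T")
      case True
      then have "S \<inter> T = {}" "S \<union> T = U" by auto
      with True show ?thesis by (simp add: bas_nth)
    next
      case False
      then have "S \<inter> T = {} \<Longrightarrow> U \<noteq> S \<union> T" by auto
      with False show ?thesis by (auto simp: bas_nth)
    qed
    finally show ?thesis .
  qed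
  then show ?thesis unfolding vec_eq_iff by blast
qed

lemma wedge_linear_simps:
  "wedge (a + b) c = wedge a c + wedge b c" "wedge a (b + c) = wedge a b + wedge a c"
  "wedge (k *s a) b = k *s wedge a b" "wedge a (k *s b) = k *s wedge a b"
  "wedge (a - b) c = wedge a c - wedge b c" "wedge a (b - c) = wedge a b - wedge a c"
  by (simp_all add: wedge_def vec_eq_iff distrib_left distrib_right sum.distrib sum_distrib_left
      left_diff_distrib right_diff_distrib sum_subtractf mult_ac)

lemma wedge_zero: "wedge 0 b = 0" "wedge b 0 = 0"
  by (simp_all add: wedge_def vec_eq_iff)

lemma tensor_bas: "tensor (bas S) (bas T) = bas (S, T)"
  by (auto simp: tensor_def vec_eq_iff axis_def)

lemma tensor_linear_simps:
  "tensor (\<phi> + \<psi>) v = tensor \<phi> v + tensor \<psi> v"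
  "tensor \<phi> (v + w) = tensor \<phi> v + tensor \<phi> w"
  "tensor (c *s \<phi>) v = c *s tensor \<phi> v"
  "tensor \<phi> (c *s v) = c *s tensor \<phi> v"
  "tensor 0 v = 0" "tensor \<phi> 0 = 0"
  by (simp_all add: tensor_def vec_eq_iff algebra_simps)

lemma tensor_diff: "tensor (a - b) v = tensor a v - tensor b v" "tensor v (a - b) = tensor v a - tensor v b"
  by (simp_all add: tensor_def vec_eq_iff algebra_simps)

definition deg :: "hb set \<times> hb set \<Rightarrow> nat" where
  "deg x = card (fst x) + card (snd x)"

text \<open>An index pair \<open>x = (S, T)\<close> stands for the basis vector \<open>e\<^sub>S \<otimes> e\<^sub>T\<close>, and the product of the basis
  vectors of disjoint index pairs is \<open>koszul x y\<close> times that of their union.  Pairs of sets form a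
  Boolean algebra, so union, difference and disjointness of index pairs are written \<open>sup\<close>, \<open>-\<close> and
  \<open>inf x y = bot\<close>.\<close>

definition koszul :: "hb set \<times> hb set \<Rightarrow> hb set \<times> hb set \<Rightarrow> 'k::field" where
  "koszul x y = shuffle_sign (fst x) (fst y) * shuffle_sign (snd x) (snd y)
     * (-1) ^ (card (fst y) * card (snd x))"

lemma disj_pair_iff: "inf x y = bot \<longleftrightarrow> fst x \<inter> fst y = {} \<and> snd x \<inter> snd y = {}"
  for x y :: "hb set \<times> hb set"
  by (cases x; cases y) (simp add: bot_prod_def)

lemma deg_sup: "inf x y = bot \<Longrightarrow> deg (sup x y) = deg x + deg y"
  by (simp add: disj_pair_iff deg_def card_Un_disjoint)

text \<open>The sign is multiplicative in each argument over disjoint unions; this is the whole reason for the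
  associativity of the product.\<close>

lemma koszul_sup_left:
  "inf x y = bot \<Longrightarrow> koszul (sup x y) z = (koszul x z * koszul y z :: 'k::field)"
  by (simp add: disj_pair_iff koszul_def shuffle_sign_Un_left card_Un_disjoint power_add
      add_mult_distrib2)

lemma koszul_sup_right:
  "inf y z = bot \<Longrightarrow> koszul x (sup y z) = (koszul x y * koszul x z :: 'k::field)"
  by (simp add: disj_pair_iff koszul_def shuffle_sign_Un_right card_Un_disjoint power_add
      add_mult_distrib)

lemma koszul_square: "koszul x y * koszul x y = (1 :: 'k::field)"
  by (simp add: koszul_def shuffle_sign_def power_mult_distrib[symmetric] mult_ac
      power_add[symmetric] flip: mult_2)

lemma koszul_swap:
  assumes "inf x y = bot"
  shows "koszul x y * koszul y x = ((-1) ^ (deg x * deg y) :: 'k::field)"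
proof -
  have "koszul x y * koszul y x
    = (shuffle_sign (fst x) (fst y) * shuffle_sign (fst y) (fst x))
      * (shuffle_sign (snd x) (snd y) * shuffle_sign (snd y) (snd x))
      * (-1) ^ (card (fst y) * card (snd x)) * ((-1) ^ (card (fst x) * card (snd y)) :: 'k)"
    by (simp add: koszul_def)
  also have "\<dots> = (-1) ^ (deg x * deg y)"
    using assms
    by (simp add: disj_pair_iff shuffle_sign_swap deg_def add_mult_distrib add_mult_distrib2 power_add mult_ac)
  finally show ?thesis .
qed

lemma koszul_bot [simp]: "koszul bot x = (1 :: 'k::field)" "koszul x bot = (1 :: 'k)"
  by (simp_all add: koszul_def shuffle_sign_def bot_prod_def)

section \<open>The supercommutative algebra of cochains\<close>

lemma vee_expand:
  "vee a b = (\<Sum>x\<in>UNIV. \<Sum>y\<in>UNIV. (a $ x * b $ y) *s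
     (if inf x y = bot then koszul x y *s bas (sup x y) else 0))"
  unfolding vee_def
proof (intro sum.cong refl, clarify, intro sum.cong refl, clarify)
  fix S1 T1 S2 T2 :: "hb set"
  show "(a $ (S1, T1) * b $ (S2, T2) * (- 1) ^ (card S2 * card T1)) *s
          tensor (wedge (bas S1) (bas S2)) (wedge (bas T1) (bas T2)) =
        (a $ (S1, T1) * b $ (S2, T2)) *s
          (if inf (S1, T1) (S2, T2) = bot
           then koszul (S1, T1) (S2, T2) *s bas (sup (S1, T1) (S2, T2)) else 0)"
    by (cases "S1 \<inter> S2 = {}"; cases "T1 \<inter> T2 = {}")
      (simp_all add: wedge_bas disj_pair_iff tensor_linear_simps tensor_bas koszul_def mult_ac
        del: inf_Pair_Pair)
qed

lemma vee_bas:
  "vee (bas x) (bas y) = (if inf x y = bot then koszul x y *s bas (sup x y) else 0)"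
proof -
  have "vee (bas x) (bas y) = (\<Sum>x'\<in>UNIV. \<Sum>y'\<in>UNIV. if y' = y then if x' = x then
     (if inf x' y' = bot then koszul x' y' *s bas (sup x' y') else 0) else 0 else 0)"
    unfolding vee_expand by (intro sum.cong refl) (auto simp: bas_nth)
  then show ?thesis by simp
qed

lemma vee_add_left: "vee (a + b) c = vee a c + vee b c"
  by (simp add: vee_expand distrib_right vec.scale_left_distrib sum.distrib)

lemma vee_add_right: "vee a (b + c) = vee a b + vee a c"
  by (simp add: vee_expand distrib_left vec.scale_left_distrib sum.distrib)

lemma vee_scale_left: "vee (k *s a) b = k *s vee a b"
  by (simp add: vee_expand vec.scale_sum_right mult.assoc cong: if_cong)

lemma vee_scale_right: "vee a (k *s b) = k *s vee a b"
  by (simp add: vee_expand vec.scale_sum_right mult.left_commute mult.assoc cong: if_cong)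

lemma vee_zero [simp]: "vee 0 a = 0" "vee a 0 = 0"
  using vee_scale_left[of 0 0 a] vee_scale_right[of a 0 0] by simp_all

lemma vee_bas_assoc:
  "vee (vee (bas x) (bas y)) (bas z) = vee (bas x) (vee (bas y) (bas z))"
  by (cases "inf x y = bot"; cases "inf x z = bot"; cases "inf y z = bot")
    (simp_all add: vee_bas vee_scale_left vee_scale_right inf_sup_distrib1 inf_sup_distrib2
      koszul_sup_left koszul_sup_right sup_assoc mult_ac)

lemma vee_assoc: "vee (vee a b) c = vee a (vee b c)"
proof -
  have 1: "vee (vee (bas x) (bas y)) c = vee (bas x) (vee (bas y) c)" for x y c
    by (rule linear_eq_on_bas[where a = c])
      (auto intro!: linearI simp: vee_bas_assoc vee_add_left vee_add_right vee_scale_left vee_scale_right)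
  have 2: "vee (vee (bas x) b) c = vee (bas x) (vee b c)" for x b c
    by (rule linear_eq_on_bas[where a = b])
      (auto intro!: linearI simp: 1 vee_add_left vee_add_right vee_scale_left vee_scale_right)
  show ?thesis
    by (rule linear_eq_on_bas[where a = a])
      (auto intro!: linearI simp: 2 vee_add_left vee_add_right vee_scale_left vee_scale_right)
qed

lemma vee_minus: "vee (- a) b = - vee a b" "vee a (- b) = - vee a b"
  using vee_scale_left[of "-1" a b] vee_scale_right[of a "-1" b] by simp_all

lemma vee_diff: "vee (a - b) c = vee a c - vee b c" "vee c (a - b) = vee c a - vee c b"
  using vee_add_left[of a "-b" c] vee_add_right[of c a "-b"] by (simp_all add: vee_minus)

lemma vee_sum_left: "vee (sum f A) b = (\<Sum>i\<in>A. vee (f i) b)"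
  by (induction A rule: infinite_finite_induct) (simp_all add: vee_add_left)

lemma vee_sum_right: "vee a (sum f A) = (\<Sum>i\<in>A. vee a (f i))"
  by (induction A rule: infinite_finite_induct) (simp_all add: vee_add_right)

lemma bas_bot: "bas ({}, {}) = bas bot"
  by (simp add: bot_prod_def)

lemma vee_one [simp]: "vee (bas bot) a = a" "vee a (bas bot) = a"
proof -
  show "vee (bas bot) a = a"
    by (rule linear_eq_on_bas[where a = a])
      (auto intro!: linearI simp: vee_bas vee_add_right vee_scale_right)
  show "vee a (bas bot) = a"
    by (rule linear_eq_on_bas[where a = a])
      (auto intro!: linearI simp: vee_bas vee_add_left vee_scale_left)
qed

definition twist :: "'k::field cochain \<Rightarrow> 'k cochain" where
  "twist a = (\<chi> x. (-1) ^ deg x * a $ x)"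

lemma twist_linear_simps:
  "twist (a + b) = twist a + twist b" "twist (k *s a) = k *s twist a"
  by (simp_all add: twist_def vec_eq_iff algebra_simps)

lemma twist_zero [simp]: "twist 0 = 0"
  using twist_linear_simps(2)[of 0 0] by simp

lemma twist_minus: "twist (- a) = - twist a"
  using twist_linear_simps(2)[of "-1" a] by simp

lemma twist_sum: "twist (sum f A) = (\<Sum>i\<in>A. twist (f i))"
  by (induction A rule: infinite_finite_induct)
    (simp_all add: twist_linear_simps)

lemma twist_twist [simp]: "twist (twist a) = a"
  by (simp add: twist_def vec_eq_iff power_mult_distrib[symmetric] flip: mult.assoc)

lemma twist_bas: "twist (bas x) = (-1) ^ deg x *s bas x"
  by (simp add: twist_def vec_eq_iff bas_nth)

lemma twist_vee: "twist (vee a b) = vee (twist a) (twist b)"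
proof -
  have 1: "twist (vee (bas x) (bas y)) = vee (twist (bas x)) (twist (bas y))" for x y
    by (simp add: vee_bas twist_bas vee_scale_left vee_scale_right twist_linear_simps deg_sup
        power_add mult_ac)
  have 2: "twist (vee (bas x) b) = vee (twist (bas x)) (twist b)" for x b
    by (rule linear_eq_on_bas[where a = b])
      (auto intro!: linearI simp: 1 twist_linear_simps vee_add_right vee_scale_right)
  show ?thesis
    by (rule linear_eq_on_bas[where a = a])
      (auto intro!: linearI simp: 2 twist_linear_simps vee_add_left vee_scale_left)
qed

text \<open>Only the parity of \<open>n\<close> matters.  Parity is expressed through the involution \<open>twist\<close> because the
  sign rules below are then identities between linear operators.\<close>

definition homog :: "nat \<Rightarrow> 'k::field cochain \<Rightarrow> bool" where
  "homog n a \<longleftrightarrow> twist a = (-1) ^ n *s a"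

lemma homog_nth: "homog n a \<Longrightarrow> a $ x \<noteq> 0 \<Longrightarrow> (-1) ^ deg x = ((-1) ^ n :: 'k::field)"
  for a :: "'k::field cochain"
  unfolding homog_def twist_def vec_eq_iff by (cases x) auto

lemma vee_bas_commute: "vee (bas x) (bas y) = (-1) ^ (deg x * deg y) *s vee (bas y) (bas x)"
proof (cases "inf x y = bot")
  case True
  have "koszul x y = (koszul x y * koszul y x) * koszul y x"
    by (simp add: mult.assoc koszul_square)
  with True show ?thesis
    by (simp add: vee_bas koszul_swap inf_commute sup_commute)
qed (simp add: vee_bas inf_commute)

text \<open>On basis vectors the two orders differ by \<open>(-1) ^ (deg x * deg y)\<close>, and for homogeneous factors this
  sign is the same for all basis vectors that occur.\<close>

lemma vee_commute:
  assumes "homog m a" "homog n b"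
  shows "vee a b = (-1) ^ (m * n) *s vee b a"
proof -
  have vee_sum: "vee c d = (\<Sum>x\<in>UNIV. \<Sum>y\<in>UNIV. (c $ x * d $ y) *s vee (bas x) (bas y))"
    for c d :: "'a cochain"
    unfolding vee_bas by (rule vee_expand)
  have "(a $ x * b $ y) *s vee (bas x) (bas y)
      = (-1) ^ (m * n) *s ((b $ y * a $ x) *s vee (bas y) (bas x))" for x y
  proof (cases "a $ x = 0 \<or> b $ y = 0")
    case False
    then have "(-1) ^ (deg x * deg y) = ((-1) ^ (m * n) :: 'a)"
      using homog_nth[OF assms(1)] homog_nth[OF assms(2)]
      by (metis power_mult mult.commute)
    then show ?thesis
      by (subst vee_bas_commute) (simp add: mult_ac)
  qed auto
  then have "vee a b = (\<Sum>x\<in>UNIV. \<Sum>y\<in>UNIV.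
      (-1) ^ (m * n) *s ((b $ y * a $ x) *s vee (bas y) (bas x)))"
    by (subst vee_sum) simp
  also have "\<dots> = (-1) ^ (m * n) *s vee b a"
    by (subst sum.swap) (simp add: vee_sum[of b a] vec.scale_sum_right)
  finally show ?thesis .
qed

lemma homog_twist: "homog n a \<Longrightarrow> homog n (twist a)"
  by (simp add: homog_def) (metis twist_twist twist_linear_simps(2))

lemma homog_bas: "homog (deg x) (bas x)"
  by (simp add: homog_def twist_bas)

section \<open>Left derivatives\<close>

text \<open>The left derivative by the generator with index \<open>u\<close>, for \<open>u\<close> a singleton index: it moves the factor
  \<open>e\<^sub>u\<close> to the front and deletes it.\<close>

definition der :: "hb set \<times> hb set \<Rightarrow> 'k::field cochain \<Rightarrow> 'k cochain" where
  "der u a = (\<Sum>x\<in>UNIV. a $ x *s (if u \<le> x then koszul u (x - u) *s bas (x - u) else 0))"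

lemma der_linear_simps:
  "der u (a + b) = der u a + der u b" "der u (k *s a) = k *s der u a"
  by (simp_all add: der_def vec.scale_left_distrib sum.distrib vec.scale_sum_right cong: if_cong)

lemma der_zero [simp]: "der u 0 = 0"
  using der_linear_simps(2)[of u 0 0] by simp

lemma der_minus: "der u (- a) = - der u a"
  using der_linear_simps(2)[of u "-1" a] by simp

lemma der_diff: "der u (a - b) = der u a - der u b"
  using der_linear_simps(1)[of u a "-b"] by (simp add: der_minus)

lemma der_sum: "der u (sum f A) = (\<Sum>i\<in>A. der u (f i))"
  by (induction A rule: infinite_finite_induct) (simp_all add: der_linear_simps)

lemma der_bas: "der u (bas x) = (if u \<le> x then koszul u (x - u) *s bas (x - u) else 0)"
proof -
  have "der u (bas x) = (\<Sum>y\<in>UNIV. if y = x then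
      (if u \<le> y then koszul u (y - u) *s bas (y - u) else 0) else 0)"
    unfolding der_def by (intro sum.cong refl) (auto simp: bas_nth)
  then show ?thesis by simp
qed

text \<open>The atoms index the six generators of the algebra of cochains.\<close>

definition atom :: "hb set \<times> hb set \<Rightarrow> bool" where
  "atom u \<longleftrightarrow> (\<exists>b. u = ({b}, {}) \<or> u = ({}, {b}))"

lemma deg_atom: "atom u \<Longrightarrow> deg u = Suc 0"
  by (auto simp: atom_def deg_def)

lemma atom_disjoint_iff: "atom u \<Longrightarrow> inf u x = bot \<longleftrightarrow> \<not> u \<le> x"
  by (cases x) (auto simp: atom_def bot_prod_def)

lemma atom_le_sup_iff: "atom u \<Longrightarrow> u \<le> sup x y \<longleftrightarrow> u \<le> x \<or> u \<le> y"
  by (cases x; cases y) (auto simp: atom_def)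

lemma pair_diff_disjoint: "inf u (x - u) = bot"
  for u x :: "hb set \<times> hb set"
  by (cases u; cases x) (auto simp: bot_prod_def)

lemma pair_sup_diff: "u \<le> x \<Longrightarrow> sup u (x - u) = x"
  for u x :: "hb set \<times> hb set"
  by (cases u; cases x) auto

lemma bas_split:
  assumes "atom u" "u \<le> x"
  shows "bas x = koszul u (x - u) *s vee (bas u) (bas (x - u))"
  using pair_diff_disjoint[of u x] pair_sup_diff[of u x] assms by (simp add: vee_bas koszul_square)

lemma vee_atom_square: "atom u \<Longrightarrow> vee (bas u) (bas u) = 0"
  using atom_disjoint_iff[of u u] by (simp add: vee_bas)

lemma der_vee_atom:
  assumes "atom u" "\<not> u \<le> x"
  shows "der u (vee (bas u) (bas x)) = bas x"
proof -
  have "sup u x - u = x" using assms by (cases x) (auto simp: atom_def)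
  with assms show ?thesis
    by (simp add: vee_bas atom_disjoint_iff der_linear_simps der_bas koszul_square)
qed

lemma der_vee_free:
  assumes "atom u" "\<not> u \<le> x" "\<not> u \<le> y"
  shows "der u (vee (bas x) (bas y)) = 0"
  using assms by (simp add: vee_bas der_linear_simps der_bas atom_le_sup_iff)

text \<open>A basis vector that contains \<open>u\<close> is \<open>\<plusminus>e\<^sub>u\<close> times one that does not.  As \<open>e\<^sub>u\<close> is odd with square zero, it
  can be moved to the front in each of the four cases, where \<open>der u\<close> simply removes it.\<close>

lemma der_vee_bas:
  assumes u: "atom u"
  shows "der u (vee (bas x) (bas y)) = vee (der u (bas x)) (bas y) + vee (twist (bas x)) (der u (bas y))"
proof -
  define E :: "'a cochain" where "E = bas u"
  note lin = vee_scale_left vee_scale_right der_linear_simps twist_linear_simps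
  have EE: "vee E E = 0" using vee_atom_square[OF u] by (simp add: E_def)
  have E1: "homog 1 E" using homog_bas[of u] deg_atom[OF u] by (simp add: E_def)
  \<comment> \<open>The rule for moving the generator to the front.\<close>
  have EX: "vee (bas z) E = vee E (twist (bas z))" for z
    using vee_commute[OF homog_bas E1, of z] by (simp add: twist_bas lin)
  have EE0: "vee E (vee E a) = 0" for a by (simp add: EE flip: vee_assoc)
  have one: "der u (vee E (vee (bas z) (bas y))) = vee (bas z) (bas y)"
    if "\<not> u \<le> z" "\<not> u \<le> y" for z y
  proof (cases "inf z y = bot")
    case True
    have "der u (vee E (bas (sup z y))) = bas (sup z y)"
      using that u by (simp add: der_vee_atom atom_le_sup_iff E_def)
    with True show ?thesis by (simp add: vee_bas[of z y] lin)
  qed (simp add: vee_bas)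
  have free: "der u (bas z) = 0" if "\<not> u \<le> z" for z using that by (simp add: der_bas)
  have E: "der u (vee E (bas z)) = bas z" if "\<not> u \<le> z" for z
    using der_vee_atom[OF u that] by (simp add: E_def)
  have nle: "\<not> u \<le> z - u" for z
    using u pair_diff_disjoint[of u z] atom_disjoint_iff by blast
  have split: "bas z = koszul u (z - u) *s vee E (bas (z - u))" if "u \<le> z" for z
    using bas_split[OF u that] by (simp add: E_def)
  have twE: "twist E = - E" using E1 by (simp add: homog_def)
  consider "\<not> u \<le> x" "\<not> u \<le> y" | "u \<le> x" "\<not> u \<le> y" | "\<not> u \<le> x" "u \<le> y" | "u \<le> x" "u \<le> y"
    by blast
  then show ?thesis
  proof cases
    case 1
    then show ?thesis using der_vee_free[OF u] by (simp add: free)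
  next
    case 2
    show ?thesis unfolding split[OF 2(1)]
      by (simp add: lin vee_assoc one nle 2 free E)
  next
    case 3
    have "vee (bas x) (vee E b) = vee E (vee (twist (bas x)) b)" for b
      by (simp add: EX flip: vee_assoc)
    then show ?thesis unfolding split[OF 3(2)]
      by (simp add: lin vee_assoc one nle 3 free E twist_bas)
  next
    case 4
    have "vee (bas z) (vee E b) = vee E (vee (twist (bas z)) b)" for z b
      by (simp add: EX flip: vee_assoc)
    then show ?thesis unfolding split[OF 4(1)] split[OF 4(2)]
      by (simp add: lin vee_assoc nle E EE0 twist_vee twE vee_minus)
  qed
qed

lemma der_vee:
  assumes u: "atom u"
  shows "der u (vee a b) = vee (der u a) b + vee (twist a) (der u b)"
proof -
  note lin = vee_scale_left vee_scale_right der_linear_simps twist_linear_simps vee_add_left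
    vee_add_right vec.scale_right_distrib
  have 1: "der u (vee (bas x) b) = vee (der u (bas x)) b + vee (twist (bas x)) (der u b)" for x b
    by (rule linear_eq_on_bas[where a = b]) (auto intro!: linearI simp: der_vee_bas[OF u] lin)
  show ?thesis
    by (rule linear_eq_on_bas[where a = a]) (auto intro!: linearI simp: 1 lin)
qed

lemma twist_der:
  assumes u: "atom u"
  shows "twist (der u a) = - der u (twist a)"
proof (rule linear_eq_on_bas[where a = a])
  fix x
  have "deg x = Suc (deg (x - u))" if "u \<le> x"
    using deg_sup[OF pair_diff_disjoint, of u x] pair_sup_diff[OF that] deg_atom[OF u] by simp
  then show "twist (der u (bas x)) = - der u (twist (bas x))"
    by (auto simp: der_bas twist_linear_simps der_linear_simps twist_bas mult_ac)
qed (auto intro!: linearI simp: der_linear_simps twist_linear_simps)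

lemma homog_der: "atom u \<Longrightarrow> homog n a \<Longrightarrow> homog (Suc n) (der u a)"
  by (simp add: homog_def twist_der der_linear_simps)

text \<open>For different \<open>u\<close> and \<open>v\<close>, removing the two generators in one order or the other gives the signs
  \<open>koszul u v\<close> and \<open>koszul v u\<close> besides common factors, and these are opposite for odd generators.\<close>

lemma der_der:
  assumes u: "atom u" and v: "atom v"
  shows "der u (der v a) = - der v (der u a)"
proof (rule linear_eq_on_bas[where a = a])
  fix x
  show "der u (der v (bas x)) = - der v (der u (bas x :: 'a cochain))"
  proof (cases "u = v \<or> \<not> u \<le> x \<or> \<not> v \<le> x")
    case True
    then show ?thesis using u v
      by (cases x) (auto simp: der_bas der_linear_simps atom_def)
  next
    case False
    then have le: "u \<le> x" "v \<le> x" and uv: "inf u v = bot"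
      using u v by (auto simp: atom_def disj_pair_iff)
    define r where "r = x - sup u v"
    obtain u1 u2 v1 v2 x1 x2 where eq: "u = (u1, u2)" "v = (v1, v2)" "x = (x1, x2)"
      by (cases u; cases v; cases x)
    have r: "x - u - v = r" "x - v - u = r" "inf v r = bot" "inf u r = bot"
      "v \<le> sup v r" "u \<le> sup u r"
      unfolding r_def eq by (auto simp: bot_prod_def)
    have r': "x - u = sup v r" "x - v = sup u r"
      using le uv unfolding r_def eq by (auto simp: bot_prod_def)
    have "koszul v u * (koszul v u * koszul u v) = - (koszul v u :: 'a)"
      using uv by (simp add: koszul_swap inf_commute deg_atom[OF u] deg_atom[OF v])
    then have kk: "koszul u v = - (koszul v u :: 'a)"
      by (simp add: koszul_square flip: mult.assoc)
    show ?thesis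
      using le r r' by (simp add: der_bas der_linear_simps koszul_sup_right) (subst kk, simp add: mult_ac)
  qed
qed (auto intro!: linearI simp: der_linear_simps)

section \<open>The super-bracket\<close>

text \<open>The canonical bracket of a Grassmann algebra whose generators come in dual pairs: \<open>prod.swap\<close>
  exchanges the index of a vector of the basis of \<open>h\<close> with that of the dual functional, and
  \<open>twist (der u a)\<close> is the right derivative of \<open>a\<close>, the derivative that deletes \<open>e\<^sub>u\<close> at the end.\<close>

definition poisson :: "'k::field cochain \<Rightarrow> 'k cochain \<Rightarrow> 'k cochain" where
  "poisson a b = (\<Sum>u | atom u. vee (twist (der u a)) (der (prod.swap u) b))"

lemma poisson_linear_simps:
  "poisson (a + b) c = poisson a c + poisson b c" "poisson a (b + c) = poisson a b + poisson a c"
  "poisson (k *s a) b = k *s poisson a b" "poisson a (k *s b) = k *s poisson a b"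
  by (simp_all add: poisson_def der_linear_simps twist_linear_simps vee_add_left vee_add_right
      vee_scale_left vee_scale_right sum.distrib vec.scale_sum_right)

lemma poisson_linear:
  "Vector_Spaces.linear (*s) (*s) (poisson a)"
  "Vector_Spaces.linear (*s) (*s) (\<lambda>a. poisson a b)"
  by (auto intro!: linearI simp: poisson_linear_simps)

lemma poisson_zero [simp]: "poisson 0 a = 0" "poisson a 0 = 0"
  using poisson_linear_simps(3)[of 0 0 a] poisson_linear_simps(4)[of a 0 0] by simp_all

lemma poisson_diff: "poisson (a - b) c = poisson a c - poisson b c"
  "poisson c (a - b) = poisson c a - poisson c b"
  using poisson_linear_simps(1)[of a "-1 *s b" c] poisson_linear_simps(2)[of c a "-1 *s b"]
    poisson_linear_simps(3)[of "-1" b c] poisson_linear_simps(4)[of c "-1" b] by simp_all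

lemma poisson_sum_left: "poisson (sum f A) b = (\<Sum>i\<in>A. poisson (f i) b)"
  by (induction A rule: infinite_finite_induct) (simp_all add: poisson_linear_simps)

lemma poisson_sum_right: "poisson a (sum f A) = (\<Sum>i\<in>A. poisson a (f i))"
  by (induction A rule: infinite_finite_induct) (simp_all add: poisson_linear_simps)

lemma atom_swap: "atom u \<Longrightarrow> atom (prod.swap u)"
  by (auto simp: atom_def)

lemma sum_atom_swap: "(\<Sum>u | atom u. f (prod.swap u) u) = (\<Sum>u | atom u. f u (prod.swap u))"
  by (rule sum.reindex_bij_witness[of _ prod.swap prod.swap]) (auto simp: atom_swap)

lemma homog_cochains:
  assumes "a \<in> cochains (int p) (int q)"
  shows "homog (p + q) a"
proof -
  have "(-1) ^ deg x * a $ x = (-1) ^ (p + q) * a $ x" for x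
    using assms by (cases x) (auto simp: cochains_def deg_def)
  then show ?thesis by (simp add: homog_def twist_def vec_eq_iff)
qed

text \<open>The derivation rule for \<open>der u\<close>, followed by moving the undifferentiated factor to the front.\<close>

lemma poisson_vee_left:
  assumes a: "homog m a" and b: "homog n b"
  shows "poisson (vee a b) c = vee a (poisson b c) + (-1) ^ (m * n) *s vee b (poisson a c)"
proof -
  have *: "vee (twist (der u (vee a b))) C
      = vee a (vee (twist (der u b)) C) + (-1) ^ (m * n) *s vee b (vee (twist (der u a)) C)"
    if u: "atom u" for u C
  proof -
    have "vee (twist (der u a)) (twist b) = (-1) ^ n *s vee (twist (der u a)) b"
      using b by (simp add: homog_def vee_scale_right)
    also have "vee (twist (der u a)) b = (-1) ^ (Suc m * n) *s vee b (twist (der u a))"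
      by (rule vee_commute[OF homog_twist[OF homog_der[OF u a]] b])
    finally have "vee (twist (der u a)) (twist b) = (-1) ^ (m * n) *s vee b (twist (der u a))"
      by (simp add: power_add)
    then show ?thesis
      by (simp add: der_vee[OF u] twist_linear_simps twist_vee vee_add_left vee_scale_left vee_assoc
          add.commute)
  qed
  show ?thesis
    by (simp add: poisson_def * sum.distrib vee_sum_right vec.scale_sum_right)
qed

text \<open>Exchanging the two factors of the summand for \<open>u\<close> turns it, up to the sign of supercommutativity, into
  the summand of \<open>poisson b a\<close> for the dual generator.\<close>

lemma poisson_antisym:
  assumes a: "homog m a" and b: "homog n b"
  shows "poisson a b = - ((-1) ^ (m * n)) *s poisson b a"
proof -
  have *: "vee (twist (der u a)) (der (prod.swap u) b)
      = - ((-1) ^ (m * n)) *s vee (twist (der (prod.swap u) b)) (der u a)" if u: "atom u" for u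
  proof -
    have ta: "twist (der u a) = (-1) ^ Suc m *s der u a"
      using homog_der[OF u a] by (simp add: homog_def)
    have tb: "twist (der (prod.swap u) b) = (-1) ^ Suc n *s der (prod.swap u) b"
      using homog_der[OF atom_swap[OF u] b] by (simp add: homog_def)
    have "vee (twist (der u a)) (der (prod.swap u) b)
      = ((-1) ^ Suc m * (-1) ^ (Suc m * Suc n)) *s vee (der (prod.swap u) b) (der u a)"
      unfolding ta vee_scale_left
      by (subst vee_commute[OF homog_der[OF u a] homog_der[OF atom_swap[OF u] b]])
        (simp add: vec.scale_scale del: power_Suc mult_Suc)
    also have "(-1) ^ Suc m * (-1) ^ (Suc m * Suc n) = (- ((-1) ^ (m * n)) * (-1) ^ Suc n :: 'a)"
      by (cases "even m"; cases "even n") simp_all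
    also have "(- ((-1) ^ (m * n)) * (-1) ^ Suc n) *s vee (der (prod.swap u) b) (der u a)
      = - ((-1) ^ (m * n)) *s vee (twist (der (prod.swap u) b)) (der u a)"
      unfolding tb vee_scale_left vec.scale_scale ..
    finally show ?thesis .
  qed
  have "poisson a b = (\<Sum>u | atom u. - ((-1) ^ (m * n)) *s vee (twist (der (prod.swap u) b)) (der u a))"
    unfolding poisson_def by (intro sum.cong refl) (use * in blast)
  also have "\<dots> = - ((-1) ^ (m * n)) *s (\<Sum>u | atom u. vee (twist (der (prod.swap u) b)) (der u a))"
    by (simp only: vec.scale_sum_right)
  also have "(\<Sum>u | atom u. vee (twist (der (prod.swap u) b)) (der u a)) = poisson b a"
    unfolding poisson_def by (rule sum_atom_swap)
  finally show ?thesis .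
qed

lemma cochains_zero: "0 \<in> cochains p q"
  by (simp add: cochains_def)

lemma cochains_add: "a \<in> cochains p q \<Longrightarrow> b \<in> cochains p q \<Longrightarrow> a + b \<in> cochains p q"
  unfolding cochains_def by (auto) (metis add.right_neutral)+

lemma cochains_scale: "a \<in> cochains p q \<Longrightarrow> k *s a \<in> cochains p q"
  by (auto simp: cochains_def)

lemma cochains_sum: "(\<And>i. i \<in> A \<Longrightarrow> f i \<in> cochains p q) \<Longrightarrow> sum f A \<in> cochains p q"
  by (induction A rule: infinite_finite_induct) (auto simp: cochains_zero cochains_add)

lemma bas_cochains: "int (card (fst x)) = p \<Longrightarrow> int (card (snd x)) = q \<Longrightarrow> bas x \<in> cochains p q"
  by (auto simp: cochains_def bas_nth split: if_splits)

lemma bas_cochains_card: "bas x \<in> cochains (int (card (fst x))) (int (card (snd x)))"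
  by (rule bas_cochains) auto

lemma vee_cochains:
  assumes a: "a \<in> cochains p1 q1" and b: "b \<in> cochains p2 q2"
  shows "vee a b \<in> cochains (p1 + p2) (q1 + q2)"
proof -
  have "(a $ x * b $ y) *s (if inf x y = bot then koszul x y *s bas (sup x y) else 0)
      \<in> cochains (p1 + p2) (q1 + q2)" for x y
  proof (cases "a $ x = 0 \<or> b $ y = 0 \<or> inf x y \<noteq> bot")
    case False
    then have xy: "a $ x \<noteq> 0" "b $ y \<noteq> 0" "inf x y = bot" by auto
    then have "int (card (fst x)) = p1" "int (card (snd x)) = q1"
      "int (card (fst y)) = p2" "int (card (snd y)) = q2"
      using a b by (cases x; cases y; simp add: cochains_def)+
    with xy show ?thesis
      by (auto intro!: cochains_scale bas_cochains simp: disj_pair_iff card_Un_disjoint)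
  qed (auto simp: cochains_zero)
  then show ?thesis unfolding vee_expand by (intro cochains_sum)
qed

lemma twist_cochains: "a \<in> cochains p q \<Longrightarrow> twist a \<in> cochains p q"
  by (simp add: cochains_def twist_def)

lemma der_cochains:
  assumes a: "a \<in> cochains p q"
  shows "der u a \<in> cochains (p - int (card (fst u))) (q - int (card (snd u)))"
proof -
  have "a $ x *s (if u \<le> x then koszul u (x - u) *s bas (x - u) else 0)
      \<in> cochains (p - int (card (fst u))) (q - int (card (snd u)))" for x
  proof (cases "a $ x = 0 \<or> \<not> u \<le> x")
    case False
    then have "a $ x \<noteq> 0" "u \<le> x" by auto
    moreover obtain u1 u2 x1 x2 where "u = (u1, u2)" "x = (x1, x2)" by (cases u; cases x)
    ultimately show ?thesis
      using a by (auto intro!: cochains_scale bas_cochains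
          simp: cochains_def[of p q] card_Diff_subset card_mono of_nat_diff)
  qed (auto simp: cochains_zero)
  then show ?thesis unfolding der_def by (intro cochains_sum)
qed

lemma poisson_cochains:
  assumes a: "a \<in> cochains p1 q1" and b: "b \<in> cochains p2 q2"
  shows "poisson a b \<in> cochains (p1 + p2 - 1) (q1 + q2 - 1)"
  unfolding poisson_def
proof (intro cochains_sum, clarify)
  fix S T :: "hb set" assume u: "atom (S, T)"
  have "vee (twist (der (S, T) a)) (der (prod.swap (S, T)) b)
    \<in> cochains ((p1 - int (card S)) + (p2 - int (card T))) ((q1 - int (card T)) + (q2 - int (card S)))"
    using vee_cochains[OF twist_cochains[OF der_cochains[OF a, of "(S, T)"]]
      der_cochains[OF b, of "prod.swap (S, T)"]] by simp
  moreover have "card S + card T = 1" using deg_atom[OF u] by (simp add: deg_def)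
  then have "p1 - int (card S) + (p2 - int (card T)) = p1 + p2 - 1"
    "q1 - int (card T) + (q2 - int (card S)) = q1 + q2 - 1" by linarith+
  ultimately show "vee (twist (der (S, T) a)) (der (prod.swap (S, T)) b)
    \<in> cochains (p1 + p2 - 1) (q1 + q2 - 1)" by simp
qed

lemma der_atom_bas: "atom u \<Longrightarrow> atom w \<Longrightarrow> der u (bas w) = (if u = w then bas bot else 0)"
  by (auto simp: der_bas atom_def bot_prod_def koszul_bot(2)[unfolded bot_prod_def])

lemma poisson_atoms:
  assumes "atom u" "atom w"
  shows "poisson (bas u) (bas w) = (if w = prod.swap u then bas bot else (0 :: 'k::field cochain))"
proof -
  have "poisson (bas u) (bas w :: 'k cochain) = (\<Sum>v | atom v. if v = u then (if w = prod.swap u then bas bot else 0) else 0)"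
    unfolding poisson_def
  proof (intro sum.cong refl)
    fix v :: "hb set \<times> hb set" assume "v \<in> {v. atom v}"
    then have v: "atom v" by simp
    have t1: "twist (bas bot :: 'k cochain) = bas bot" by (simp add: twist_bas deg_def bot_prod_def)
    show "vee (twist (der v (bas u))) (der (prod.swap v) (bas w))
      = (if v = u then (if w = prod.swap u then bas bot else 0) else (0 :: 'k cochain))"
      by (auto simp: der_atom_bas v atom_swap assms t1)
  qed
  with assms show ?thesis by simp
qed

lemma ext_incl_bas: "ext_incl (bas i) = bas {i}"
  by (simp add: ext_incl_def bas_nth if_distrib[of "\<lambda>k. k *s _"] cong: if_cong)

lemma ext_incl_linear_simps:
  "ext_incl (a + b) = ext_incl a + ext_incl b" "ext_incl (k *s a) = k *s ext_incl a"
  "ext_incl (a - b) = ext_incl a - ext_incl b"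
  by (simp_all add: ext_incl_def vec.scale_left_distrib vec.scale_left_diff_distrib sum.distrib
      sum_subtractf vec.scale_sum_right)

lemma of_heis_expand: "of_heis v = (\<Sum>b\<in>UNIV. v $ b *s bas ({}, {b}))"
proof -
  have "tensor \<phi> (sum f A) = (\<Sum>i\<in>A. tensor \<phi> (f i))" for \<phi> :: "'a ext" and f :: "hb \<Rightarrow> 'a ext" and A
    by (induction A rule: infinite_finite_induct) (simp_all add: tensor_linear_simps)
  then show ?thesis by (simp add: of_heis_def ext_incl_def tensor_linear_simps tensor_bas)
qed

lemma of_dual_expand: "of_dual v = (\<Sum>b\<in>UNIV. v $ b *s bas ({b}, {}))"
proof -
  have "tensor (sum f A) \<phi> = (\<Sum>i\<in>A. tensor (f i) \<phi>)" for \<phi> :: "'a ext" and f :: "hb \<Rightarrow> 'a ext" and A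
    by (induction A rule: infinite_finite_induct) (simp_all add: tensor_linear_simps)
  then show ?thesis by (simp add: of_dual_def ext_incl_def tensor_linear_simps tensor_bas)
qed

lemma poisson_is_super_bracket: "is_super_bracket (poisson :: 'k::field cochain \<Rightarrow> _)"
proof -
  have at: "atom ({b}, {})" "atom ({}, {b})" for b by (auto simp: atom_def)
  note ex = of_heis_expand of_dual_expand poisson_sum_left poisson_sum_right poisson_linear_simps
    poisson_atoms[OF at(1) at(1)] poisson_atoms[OF at(1) at(2)] poisson_atoms[OF at(2) at(1)]
    poisson_atoms[OF at(2) at(2)]
  have if0: "(k *s (if P then bas ({}, {}) else 0)) = (if P then k *s bas ({}, {}) else 0)"
    for k :: 'k and P by simp
  have 1: "poisson (of_dual \<phi>) (of_heis v) = pairing \<phi> v *s bas ({}, {})"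
    "poisson (of_heis v) (of_dual \<phi>) = pairing \<phi> v *s bas ({}, {})" for \<phi> v :: "'k heis"
    by (simp_all add: ex pairing_def UNIV_hb vec.scale_left_distrib mult_ac bas_bot)
  have 2: "poisson (of_dual \<phi>) (of_dual v) = 0"
    "poisson (of_heis v) (of_heis \<phi>) = 0" for \<phi> v :: "'k heis"
    by (simp_all add: ex)
  show ?thesis unfolding is_super_bracket_def
    by (intro conjI allI ballI poisson_linear poisson_cochains 1 2
        poisson_antisym[OF homog_cochains homog_cochains]
        poisson_vee_left[OF homog_cochains homog_cochains])
qed

text \<open>The Leibniz rule expresses the bracket of a product through brackets of its factors, so a bracket
  is determined in its first argument by its values on the generators and on \<open>1\<close>, where it vanishes
  because \<open>1\<close> is idempotent.  Antisymmetry makes the same reduction available for the second argument, and the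
  brackets of two generators are prescribed.\<close>

lemma super_bracket_unique:
  fixes br br' :: "'k::field cochain \<Rightarrow> 'k cochain \<Rightarrow> 'k cochain"
  assumes br: "is_super_bracket br" and br': "is_super_bracket br'"
  shows "br = br'"
proof -
  have one: "b (bas bot) c = 0" if "is_super_bracket b" for b :: "'k cochain \<Rightarrow> _" and c
  proof -
    have "bas bot \<in> cochains (int 0) (int 0)" by (rule bas_cochains) (simp_all add: bot_prod_def)
    then have "b (vee (bas bot) (bas bot)) c = vee (bas bot) (b (bas bot) c)
        + (-1) ^ ((0 + 0) * (0 + 0)) *s vee (bas bot) (b (bas bot) c)"
      using that unfolding is_super_bracket_def by blast
    then show ?thesis by simp
  qed
  \<comment> \<open>For a fixed second argument, agreement on the generators suffices; split one generator off.\<close>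
  have step: "br (bas x) c = br' (bas x) c"
    if gen: "\<And>u. atom u \<Longrightarrow> br (bas u) c = br' (bas u) c" for c x
  proof (induction "deg x" arbitrary: x)
    case 0
    then have "x = bot" by (cases x) (simp add: deg_def bot_prod_def)
    then show ?case using one[OF br] one[OF br'] by simp
  next
    case (Suc n)
    obtain u where u: "atom u" "u \<le> x"
    proof (cases x)
      case (Pair S T)
      with Suc.hyps(2) have "S \<noteq> {} \<or> T \<noteq> {}" by (auto simp: deg_def)
      then obtain b where "b \<in> S \<or> b \<in> T" by auto
      then show thesis
        using that[of "({b}, {})"] that[of "({}, {b})"] Pair by (auto simp: atom_def)
    qed
    define y where "y = x - u"
    have "deg y = n"
      using Suc.hyps(2) deg_sup[OF pair_diff_disjoint[of u x]] pair_sup_diff[OF u(2)] deg_atom[OF u(1)]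
      by (simp add: y_def)
    then have y: "br (bas y) c = br' (bas y) c" using Suc.hyps(1) by blast
    have L: "b (bas x) c = koszul u y *s (vee (bas u) (b (bas y) c)
        + (-1) ^ ((card (fst u) + card (snd u)) * (card (fst y) + card (snd y))) *s vee (bas y) (b (bas u) c))"
      if b: "is_super_bracket b" for b :: "'k cochain \<Rightarrow> 'k cochain \<Rightarrow> 'k cochain"
    proof -
      have "b (bas x) c = b (koszul u y *s vee (bas u) (bas y)) c"
        unfolding y_def bas_split[OF u, symmetric] ..
      also have "\<dots> = koszul u y *s b (vee (bas u) (bas y)) c"
        using b unfolding is_super_bracket_def by (metis vec.linear_scale)
      also have "b (vee (bas u) (bas y)) c = vee (bas u) (b (bas y) c)
        + (-1) ^ ((card (fst u) + card (snd u)) * (card (fst y) + card (snd y))) *s vee (bas y) (b (bas u) c)"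
        using b bas_cochains_card[of u] bas_cochains_card[of y] unfolding is_super_bracket_def by blast
      finally show ?thesis .
    qed
    show ?case unfolding L[OF br] L[OF br'] by (simp add: y gen u)
  qed
  have gens: "b (bas u) (bas w) = (if w = prod.swap u then bas bot else 0)"
    if b: "is_super_bracket b" and u: "atom u" and w: "atom w" for b :: "'k cochain \<Rightarrow> _" and u w
  proof -
    have h: "bas ({}, {c}) = of_heis (bas c)" and d: "bas ({c}, {}) = of_dual (bas c)" for c
      by (simp_all add: of_heis_expand of_dual_expand bas_nth if_distrib[of "\<lambda>k. k *s _"] cong: if_cong)
    have p: "pairing (bas c) (bas d) = (if c = d then 1 else 0 :: 'k)" for c d
      by (simp add: pairing_def bas_nth if_distrib[of "\<lambda>k. _ * k"] cong: if_cong)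
    have "b (of_heis x) (of_heis y) = 0" "b (of_dual x) (of_dual y) = 0"
      "b (of_dual x) (of_heis y) = pairing x y *s bas ({}, {})"
      "b (of_heis y) (of_dual x) = pairing x y *s bas ({}, {})" for x y
      using b unfolding is_super_bracket_def by blast+
    then show ?thesis
      using u w unfolding atom_def by (elim exE disjE) (auto simp: h d p bas_bot)
  qed
  \<comment> \<open>Antisymmetry puts the generator second, where the previous reduction applies.\<close>
  have gen: "br (bas u) c = br' (bas u) c" if u: "atom u" for u c
  proof (rule linear_eq_on_bas[where a = c])
    fix y
    have "br (bas y) (bas u) = br' (bas y) (bas u)"
      by (rule step) (simp add: gens br br' u)
    moreover have "b (bas u) (bas y) = - ((-1) ^ ((card (fst u) + card (snd u)) * (card (fst y) + card (snd y))))
      *s b (bas y) (bas u)" if "is_super_bracket b" for b :: "'k cochain \<Rightarrow> 'k cochain \<Rightarrow> 'k cochain"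
      using that bas_cochains_card[of u] bas_cochains_card[of y] unfolding is_super_bracket_def by blast
    ultimately show "br (bas u) (bas y) = br' (bas u) (bas y)" using br br' by metis
  qed (use br br' in \<open>auto simp: is_super_bracket_def\<close>)
  have "br a c = br' a c" for a c
    by (rule linear_eq_on_bas[where a = a])
      (use br br' step[OF gen] in \<open>auto simp: is_super_bracket_def\<close>)
  then show ?thesis by blast
qed

lemma super_bracket_eq: "super_bracket = (poisson :: 'k::field cochain \<Rightarrow> _)"
  unfolding super_bracket_def
  by (intro the_equality poisson_is_super_bracket super_bracket_unique)

section \<open>Brackets with an odd element\<close>

lemma vee_even_commute: "homog 0 w \<Longrightarrow> vee w a = vee a w"
proof (rule linear_eq_on_bas[where a = a])
  fix x assume "homog 0 w"
  from vee_commute[OF this homog_bas[of x]] show "vee w (bas x) = vee (bas x) w" by simp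
qed (auto intro!: linearI simp: vee_add_left vee_scale_left vee_add_right vee_scale_right)

lemma vee_odd_commute: "homog 1 m \<Longrightarrow> vee a m = vee m (twist a)"
proof (rule linear_eq_on_bas[where a = a])
  fix x assume "homog 1 m"
  from vee_commute[OF homog_bas[of x] this] show "vee (bas x) m = vee m (twist (bas x))"
    by (simp add: twist_bas vee_scale_right)
qed (auto intro!: linearI simp: vee_add_left vee_scale_left vee_add_right vee_scale_right
      twist_linear_simps)

text \<open>For odd \<open>M\<close> the operator \<open>poisson M\<close> is the vector field \<open>\<Sum>\<^sub>u coef u \<cdot> der (swap u)\<close> with even
  coefficients.  That the coefficients commute with everything gives its derivation property, and that
  they are themselves derivatives of one function gives the Jacobi identity.\<close>

context
  fixes M :: "'k::field cochain"
  assumes M: "homog 1 M"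
begin

definition coef :: "hb set \<times> hb set \<Rightarrow> 'k cochain" where "coef u = der u M"

lemma coef_even: "atom u \<Longrightarrow> homog 0 (coef u)"
  using homog_der[OF _ M, of u] by (simp add: coef_def homog_def)

lemma der_coef_odd: "atom u \<Longrightarrow> atom v \<Longrightarrow> homog 1 (der v (coef u))"
  using homog_der[OF _ coef_even, of v u] by simp

lemma der_coef_antisym: "atom u \<Longrightarrow> atom v \<Longrightarrow> der v (coef u) = - der u (coef v)"
  unfolding coef_def by (rule der_der)

lemma twist_coef: "atom u \<Longrightarrow> twist (coef u) = coef u"
  using coef_even[of u] by (simp add: homog_def)

lemma ham_expand: "poisson M a = (\<Sum>u | atom u. vee (coef u) (der (prod.swap u) a))"
  unfolding poisson_def by (intro sum.cong refl) (simp add: twist_coef[unfolded coef_def] coef_def)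

lemma ham_vee: "poisson M (vee a b) = vee (poisson M a) b + vee (twist a) (poisson M b)"
proof -
  have "vee (coef u) (der (prod.swap u) (vee a b)) = vee (vee (coef u) (der (prod.swap u) a)) b
      + vee (twist a) (vee (coef u) (der (prod.swap u) b))" if u: "atom u" for u
  proof -
    have "vee (coef u) (vee (twist a) c) = vee (twist a) (vee (coef u) c)" for c
      using vee_even_commute[OF coef_even[OF u], of "twist a"] by (simp flip: vee_assoc)
    then show ?thesis
      by (simp add: der_vee[OF atom_swap[OF u]] vee_add_right vee_assoc)
  qed
  then show ?thesis
    by (simp add: ham_expand sum.distrib vee_sum_left vee_sum_right)
qed

lemma twist_ham: "twist (poisson M a) = - poisson M (twist a)"
  by (simp add: ham_expand twist_sum twist_vee twist_coef twist_der atom_swap vee_minus sum_negf)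

lemma der_ham:
  assumes v: "atom v"
  shows "der v (poisson M a) =
    (\<Sum>u | atom u. vee (der v (coef u)) (der (prod.swap u) a)) - poisson M (der v a)"
proof -
  have "der v (vee (coef u) (der (prod.swap u) a))
      = vee (der v (coef u)) (der (prod.swap u) a) - vee (coef u) (der (prod.swap u) (der v a))"
    if u: "atom u" for u
    by (simp add: der_vee[OF v] twist_coef[OF u] der_der[OF v atom_swap[OF u]] vee_minus)
  then show ?thesis
    by (simp add: ham_expand der_sum sum_subtractf)
qed

text \<open>Differentiating the formula for the bracket reproduces the right hand side up to the terms \<open>X\<close> and
  \<open>Y\<close> in which \<open>M\<close> is differentiated twice.  They cancel because left derivatives anticommute.\<close>

lemma ham_poisson:
  "poisson M (poisson a b) = poisson (poisson M a) b + poisson (twist a) (poisson M b)"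
proof -
  let ?s = "prod.swap :: hb set \<times> hb set \<Rightarrow> _"
  define X where "X = (\<Sum>u | atom u. \<Sum>v | atom v.
    vee (vee (der u (coef v)) (twist (der (?s v) a))) (der (?s u) b))"
  define Y where "Y = (\<Sum>u | atom u. \<Sum>v | atom v.
    vee (vee (der (?s u) (coef v)) (twist (der u a))) (der (?s v) b))"
  define P where "P = (\<Sum>u | atom u. vee (poisson M (twist (der u a))) (der (?s u) b))"
  define Q where "Q = (\<Sum>u | atom u. vee (der u a) (poisson M (der (?s u) b)))"
  have "poisson M (poisson a b) = P + Q"
    unfolding poisson_def[of a b] poisson_sum_right P_def Q_def sum.distrib[symmetric]
    by (intro sum.cong refl) (simp add: ham_vee)
  moreover have "poisson (poisson M a) b = P - X"
  proof -
    have "vee (twist (der u (poisson M a))) (der (?s u) b) =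
        vee (poisson M (twist (der u a))) (der (?s u) b) -
        (\<Sum>v | atom v. vee (vee (der u (coef v)) (twist (der (?s v) a))) (der (?s u) b))"
      if u: "atom u" for u
    proof -
      have "twist (vee (der u (coef v)) c) = - vee (der u (coef v)) (twist c)" if "atom v" for v c
        using der_coef_odd[OF that u] by (simp add: twist_vee homog_def vee_minus)
      then have "twist (der u (poisson M a)) = poisson M (twist (der u a))
          - (\<Sum>v | atom v. vee (der u (coef v)) (twist (der (?s v) a)))"
        by (simp add: der_ham[OF u] twist_ham twist_sum sum_negf diff_conv_add_uminus
            twist_linear_simps twist_minus del: add_uminus_conv_diff)
      then show ?thesis by (simp add: vee_diff vee_sum_left)
    qed
    then show ?thesis
      unfolding poisson_def[of "poisson M a"] P_def X_def by (simp add: sum_subtractf)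
  qed
  moreover have "poisson (twist a) (poisson M b) = Q - Y"
  proof -
    have "vee (twist (der u (twist a))) (der (?s u) (poisson M b)) =
        vee (der u a) (poisson M (der (?s u) b)) -
        (\<Sum>v | atom v. vee (vee (der (?s u) (coef v)) (twist (der u a))) (der (?s v) b))"
      if u: "atom u" for u
    proof -
      have "vee (der u a) (vee (der (?s u) (coef v)) c)
          = vee (vee (der (?s u) (coef v)) (twist (der u a))) c" if v: "atom v" for v c
        using vee_odd_commute[OF der_coef_odd[OF v atom_swap[OF u]], of "der u a"]
        by (simp flip: vee_assoc)
      then show ?thesis
        by (simp add: twist_der[OF u] der_ham[OF atom_swap[OF u]] vee_minus vee_diff vee_sum_right
            sum_negf)
    qed
    then show ?thesis
      unfolding poisson_def[of "twist a"] Q_def Y_def by (simp add: sum_subtractf)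
  qed
  \<comment> \<open>Reindexing \<open>Y\<close> by the dual generator exchanges the roles of the two derivatives of \<open>M\<close>.\<close>
  moreover have "X + Y = 0"
  proof -
    have "Y = (\<Sum>u | atom u. \<Sum>v | atom v.
        vee (vee (der u (coef v)) (twist (der (?s u) a))) (der (?s v) b))"
      unfolding Y_def
      by (rule sum.reindex_bij_witness[of _ ?s ?s]) (auto simp: atom_swap)
    also have "\<dots> = (\<Sum>u | atom u. \<Sum>v | atom v.
        - vee (vee (der v (coef u)) (twist (der (?s u) a))) (der (?s v) b))"
    proof (intro sum.cong refl)
      fix u v :: "hb set \<times> hb set" assume "u \<in> Collect atom" "v \<in> Collect atom"
      then have "der u (coef v) = - der v (coef u)" by (intro der_coef_antisym) auto
      then show "vee (vee (der u (coef v)) (twist (der (?s u) a))) (der (?s v) b)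
          = - vee (vee (der v (coef u)) (twist (der (?s u) a))) (der (?s v) b)"
        by (simp add: vee_minus)
    qed
    also have "\<dots> = - X"
      unfolding X_def by (subst sum.swap) (simp add: sum_negf)
    finally show ?thesis by simp
  qed
  ultimately show ?thesis by (simp add: algebra_simps add_eq_0_iff)
qed

end

section \<open>Monomials\<close>

text \<open>With truth values as coordinates, calculations with concrete index sets become evaluations of
  propositional formulas.\<close>

definition hset :: "bool \<Rightarrow> bool \<Rightarrow> bool \<Rightarrow> hb set" where
  "hset a b c = {x. case x of Xp \<Rightarrow> a | Xm \<Rightarrow> b | H0 \<Rightarrow> c}"

lemma mem_hset: "x \<in> hset a b c \<longleftrightarrow> (case x of Xp \<Rightarrow> a | Xm \<Rightarrow> b | H0 \<Rightarrow> c)"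
  by (simp add: hset_def)

lemma hb_all: "(\<forall>x. P x) \<longleftrightarrow> P Xp \<and> P Xm \<and> P H0"
  by (metis hb.exhaust)

lemma hb_ex: "(\<exists>x. P x) \<longleftrightarrow> P Xp \<or> P Xm \<or> P H0"
  by (metis hb.exhaust)

lemma hset_cases: obtains a b c where "S = hset a b c"
proof -
  have "S = hset (Xp \<in> S) (Xm \<in> S) (H0 \<in> S)"
    by (simp add: set_eq_iff mem_hset hb_all)
  then show thesis by (rule that)
qed

lemma hset_simps:
  "hset a b c \<union> hset a' b' c' = hset (a \<or> a') (b \<or> b') (c \<or> c')"
  "hset a b c \<inter> hset a' b' c' = hset (a \<and> a') (b \<and> b') (c \<and> c')"
  "hset a b c - hset a' b' c' = hset (a \<and> \<not> a') (b \<and> \<not> b') (c \<and> \<not> c')"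
  "hset a b c \<subseteq> hset a' b' c' \<longleftrightarrow> (a \<longrightarrow> a') \<and> (b \<longrightarrow> b') \<and> (c \<longrightarrow> c')"
  "hset a b c = hset a' b' c' \<longleftrightarrow> a = a' \<and> b = b' \<and> c = c'"
  by (auto simp: set_eq_iff subset_iff mem_hset hb_all)

lemma hset_folds:
  "{} = hset False False False" "insert Xp (hset a b c) = hset True b c"
  "insert Xm (hset a b c) = hset a True c" "insert H0 (hset a b c) = hset a b True"
  by (simp_all add: set_eq_iff mem_hset hb_all)

lemma hset_set:
  "hset a b c = set ((if a then [Xp] else []) @ (if b then [Xm] else []) @ (if c then [H0] else []))"
  by (auto simp: set_eq_iff mem_hset hb_all)

lemma hb_less [simp]: "Xp < Xm" "Xp < H0" "Xm < H0" "\<not> Xm < Xp" "\<not> H0 < Xp" "\<not> H0 < Xm"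
  by (simp_all add: less_hb_def)

lemma hb_le [simp]: "Xp \<le> Xm" "Xp \<le> H0" "Xm \<le> H0"
  by (simp_all add: less_eq_hb_def)

lemma sorted_list_hset: "sorted_list_of_set (hset a b c)
    = (if a then [Xp] else []) @ (if b then [Xm] else []) @ (if c then [H0] else [])"
  unfolding hset_set by (rule sorted_list_of_set.idem_if_sorted_distinct) auto

lemma card_hset: "card (hset a b c) = of_bool a + of_bool b + of_bool c"
  unfolding hset_set by simp

lemma shuffle_sign_hset: "shuffle_sign (hset a b c) (hset a' b' c')
    = (if b \<and> a' then -1 else 1) * (if c \<and> a' then -1 else 1) * (if c \<and> b' then -1 else 1 :: 'k::field)"
proof -
  have "{(s, t). s \<in> hset a b c \<and> t \<in> hset a' b' c' \<and> t < s}
    = set ((if b \<and> a' then [(Xm, Xp)] else []) @ (if c \<and> a' then [(H0, Xp)] else [])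
       @ (if c \<and> b' then [(H0, Xm)] else []))"
    (is "?A = set ?l")
  proof -
    have "(s, t) \<in> ?A \<longleftrightarrow> (s, t) \<in> set ?l" for s t
      by (cases s; cases t) (auto simp: mem_hset)
    then show ?thesis by auto
  qed
  then have "card ?A = length ?l"
    by (simp add: distinct_card)
  then show ?thesis unfolding shuffle_sign_def by simp
qed

text \<open>The first three truth values select the factors \<open>x\<^sup>-\<^sup>1\<close>, \<open>x\<^sup>1\<close>, \<open>h\<^sup>0\<close>, the last three the factors \<open>x\<^sub>1\<close>,
  \<open>x\<^sub>-\<^sub>1\<close>, \<open>h\<^sub>0\<close>.\<close>

definition mon :: "bool \<Rightarrow> bool \<Rightarrow> bool \<Rightarrow> bool \<Rightarrow> bool \<Rightarrow> bool \<Rightarrow> 'k::field cochain" where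
  "mon a b c a' b' c' = bas (hset a b c, hset a' b' c')"

lemma koszul_hset: "koszul (hset a b c, hset a' b' c') (hset p q r, hset p' q' r')
  = (if b \<and> p then -1 else 1) * (if c \<and> p then -1 else 1) * (if c \<and> q then -1 else 1)
       * (if b' \<and> p' then -1 else 1) * (if c' \<and> p' then -1 else 1) * (if c' \<and> q' then -1 else 1)
       * (-1) ^ ((of_bool p + of_bool q + of_bool r) * (of_bool a' + of_bool b' + of_bool c'))"
  unfolding koszul_def fst_conv snd_conv shuffle_sign_hset card_hset mult.assoc ..

lemma vee_mon: "vee (mon a b c a' b' c') (mon p q r p' q' r')
  = (if a \<and> p \<or> b \<and> q \<or> c \<and> r \<or> a' \<and> p' \<or> b' \<and> q' \<or> c' \<and> r' then 0
     else koszul (hset a b c, hset a' b' c') (hset p q r, hset p' q' r') *s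
       mon (a \<or> p) (b \<or> q) (c \<or> r) (a' \<or> p') (b' \<or> q') (c' \<or> r'))"
proof -
  have "inf (hset a b c, hset a' b' c') (hset p q r, hset p' q' r') = bot
      \<longleftrightarrow> \<not> (a \<and> p \<or> b \<and> q \<or> c \<and> r \<or> a' \<and> p' \<or> b' \<and> q' \<or> c' \<and> r')"
    by (simp add: bot_prod_def hset_simps hset_folds(1))
  then show ?thesis by (simp add: mon_def vee_bas hset_simps)
qed

lemma der_mon: "der (hset p q r, hset p' q' r') (mon a b c a' b' c')
  = (if (p \<longrightarrow> a) \<and> (q \<longrightarrow> b) \<and> (r \<longrightarrow> c) \<and> (p' \<longrightarrow> a') \<and> (q' \<longrightarrow> b') \<and> (r' \<longrightarrow> c')
     then koszul (hset p q r, hset p' q' r')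
        (hset (a \<and> \<not> p) (b \<and> \<not> q) (c \<and> \<not> r), hset (a' \<and> \<not> p') (b' \<and> \<not> q') (c' \<and> \<not> r')) *s
       mon (a \<and> \<not> p) (b \<and> \<not> q) (c \<and> \<not> r) (a' \<and> \<not> p') (b' \<and> \<not> q') (c' \<and> \<not> r') else 0)"
  by (simp add: mon_def der_bas hset_simps)

lemma twist_mon: "twist (mon a b c a' b' c') =
    (-1) ^ (of_bool a + of_bool b + of_bool c + of_bool a' + of_bool b' + of_bool c') *s mon a b c a' b' c'"
  by (simp add: mon_def twist_bas deg_def card_hset add_ac)

abbreviation "\<xi>p \<equiv> (hset True False False, hset False False False)"
abbreviation "\<xi>m \<equiv> (hset False True False, hset False False False)"
abbreviation "\<xi>h \<equiv> (hset False False True, hset False False False)"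
abbreviation "xp \<equiv> (hset False False False, hset True False False)"
abbreviation "xm \<equiv> (hset False False False, hset False True False)"
abbreviation "xh \<equiv> (hset False False False, hset False False True)"

lemma atoms_eq: "Collect atom = {\<xi>p, \<xi>m, \<xi>h, xp, xm, xh}"
proof -
  have "atom u \<longleftrightarrow> u \<in> {\<xi>p, \<xi>m, \<xi>h, xp, xm, xh}" for u
    by (cases u) (auto simp: atom_def hset_folds hset_simps hb_ex)
  then show ?thesis by blast
qed

lemma poisson_expand: "poisson a b =
   vee (twist (der \<xi>p a)) (der xp b) + vee (twist (der \<xi>m a)) (der xm b) + vee (twist (der \<xi>h a)) (der xh b)
 + vee (twist (der xp a)) (der \<xi>p b) + vee (twist (der xm a)) (der \<xi>m b) + vee (twist (der xh a)) (der \<xi>h b)"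
  unfolding poisson_def atoms_eq by (simp add: hset_simps add_ac)

lemma mu_mon: "mu = mon True True False False False True"
  by (simp add: mu_def ext_incl_bas hset_folds wedge_bas hset_simps shuffle_sign_hset
      tensor_linear_simps tensor_bas mon_def)

lemma homog_mu: "homog 1 mu"
  using homog_bas[of "(hset True True False, hset False False True)"]
  by (simp add: mu_mon mon_def homog_def deg_def card_hset)

lemma mon_nth: "mon a b c a' b' c' $ (hset p q r, hset p' q' r')
    = (if a = p \<and> b = q \<and> c = r \<and> a' = p' \<and> b' = q' \<and> c' = r' then 1 else 0)"
  by (auto simp: mon_def bas_nth hset_simps)

lemmas mon_eval = vee_mon der_mon koszul_hset twist_mon der_linear_simps twist_linear_simps
  twist_minus vee_minus vee_add_left vee_add_right vee_scale_left vee_scale_right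

lemma ce_diff_expand: "ce_diff a = vee (mon False True False False False True) (der xp a)
   - vee (mon True False False False False True) (der xm a)
   + vee (mon True True False False False False) (der \<xi>h a)"
  by (simp add: ce_diff_def super_bracket_eq poisson_expand mu_mon mon_eval vee_minus)

section \<open>The differential and the bracket of cohomology classes\<close>

lemma ce_diff_linear_simps:
  "ce_diff (a + b) = ce_diff a + ce_diff b" "ce_diff (k *s a) = k *s ce_diff a"
  "ce_diff 0 = 0" "ce_diff (- a) = - ce_diff a" "ce_diff (a - b) = ce_diff a - ce_diff b"
  using poisson_linear_simps(4)[of mu "-1" a] poisson_linear_simps(4)[of mu "-1" b]
    poisson_linear_simps(2)[of mu a "-b"]
  by (simp_all add: ce_diff_def super_bracket_eq poisson_linear_simps)

lemma ce_diff_bracket: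
  "ce_diff (poisson a b) = poisson (ce_diff a) b + poisson (twist a) (ce_diff b)"
  unfolding ce_diff_def super_bracket_eq by (rule ham_poisson[OF homog_mu])

lemma twist_ce_diff: "twist (ce_diff a) = - ce_diff (twist a)"
  unfolding ce_diff_def super_bracket_eq by (rule twist_ham[OF homog_mu])

lemma ce_diff_mu: "ce_diff mu = 0"
  by (simp add: ce_diff_expand mu_mon mon_eval)

text \<open>The Jacobi identity for \<open>mu\<close> gives \<open>d (d b) = - d (d b)\<close> because \<open>mu\<close> is odd and \<open>d mu = 0\<close>.\<close>

lemma ce_diff_square: "ce_diff (ce_diff b) = (0 :: 'k::field_char_0 cochain)"
proof -
  have "twist mu = (- mu :: 'k cochain)"
    using homog_mu by (simp add: homog_def)
  then have "ce_diff (ce_diff b) = - ce_diff (ce_diff b)"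
    using ce_diff_bracket[of mu b] poisson_linear_simps(3)[of "-1" mu "ce_diff b"]
    by (simp add: ce_diff_mu) (simp add: ce_diff_def super_bracket_eq)
  then have "(2::'k) * ce_diff (ce_diff b) $ x = 0" for x
    by (metis add_eq_0_iff mult_2 vector_uminus_component)
  then show ?thesis by (simp add: vec_eq_iff)
qed

lemma cls_eq_iff: "cls a = cls b \<longleftrightarrow> (\<exists>c. a = b + ce_diff c)"
proof
  assume "cls a = cls b"
  moreover have "a \<in> cls a" unfolding cls_def using ce_diff_linear_simps(3) by force
  ultimately show "\<exists>c. a = b + ce_diff c" by (auto simp: cls_def)
next
  assume "\<exists>c. a = b + ce_diff c"
  then obtain c where c: "a = b + ce_diff c" by blast
  have "x = a + ce_diff e \<Longrightarrow> x = b + ce_diff (c + e)"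
    "x = b + ce_diff e \<Longrightarrow> x = a + ce_diff (e - c)" for x e
    by (simp_all add: c ce_diff_linear_simps)
  then have "(\<exists>e. x = a + ce_diff e) \<longleftrightarrow> (\<exists>e. x = b + ce_diff e)" for x
    by blast
  then show "cls a = cls b" by (simp add: cls_def)
qed

lemma rep_cls: obtains c where "rep (cls a) = a + ce_diff c"
proof -
  have "a \<in> cls a" unfolding cls_def using ce_diff_linear_simps(3) by force
  then have "rep (cls a) \<in> cls a" unfolding rep_def by (rule someI)
  then show thesis using that by (auto simp: cls_def)
qed

lemma hadd_cls: "hadd (cls a) (cls b) = cls (a + b)"
proof -
  obtain c e where "rep (cls a) = a + ce_diff c" "rep (cls b) = b + ce_diff e"
    by (metis rep_cls)
  then have "rep (cls a) + rep (cls b) = (a + b) + ce_diff (c + e)"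
    by (simp add: ce_diff_linear_simps)
  then show ?thesis unfolding hadd_def cls_eq_iff by blast
qed

lemma hscale_cls: "hscale k (cls a) = cls (k *s a)"
proof -
  obtain c where "rep (cls a) = a + ce_diff c" by (metis rep_cls)
  then have "k *s rep (cls a) = k *s a + ce_diff (k *s c)"
    by (simp add: ce_diff_linear_simps vec.scale_right_distrib)
  then show ?thesis unfolding hscale_def cls_eq_iff by blast
qed

text \<open>Instances of the Jacobi identity, with \<open>twist a\<close> accounting for the sign that the odd operator \<open>d\<close>
  picks up when it passes \<open>a\<close>.\<close>

lemma poisson_exact_right:
  assumes "ce_diff a = 0" shows "poisson a (ce_diff b) = ce_diff (poisson (twist a) b)"
  using ce_diff_bracket[of "twist a" b] twist_ce_diff[of a] assms
  by simp

lemma poisson_exact_left: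
  assumes "ce_diff a = 0" shows "poisson (ce_diff b) a = ce_diff (poisson b a)"
  using ce_diff_bracket[of b a] assms by simp

text \<open>The representatives chosen for the two classes differ from \<open>a\<close> and \<open>b\<close> by coboundaries, and the
  bracket of a cocycle with a coboundary is a coboundary.\<close>

lemma hbracket_cls:
  fixes a b :: "'k::field_char_0 cochain"
  assumes "ce_diff a = 0" "ce_diff b = 0"
  shows "hbracket (cls a) (cls b) = cls (poisson a b)"
proof -
  obtain c e where ce: "rep (cls a) = a + ce_diff c" "rep (cls b) = b + ce_diff e"
    by (metis rep_cls)
  have "ce_diff (b + ce_diff e) = 0" by (simp add: ce_diff_linear_simps ce_diff_square assms)
  then have "poisson (rep (cls a)) (rep (cls b))
      = poisson a b + ce_diff (poisson (twist a) e + poisson c (b + ce_diff e))"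
    unfolding ce poisson_linear_simps(1)
    by (simp add: poisson_exact_left) (simp add: poisson_linear_simps poisson_exact_right[OF assms(1)] ce_diff_linear_simps)
  then show ?thesis unfolding hbracket_def super_bracket_eq cls_eq_iff by blast
qed

section \<open>Equivariance of the differential\<close>

lemma ext_map_bas:
  "ext_map f (bas S) = foldr wedge (map (\<lambda>i. ext_incl (f (bas i))) (sorted_list_of_set S)) (bas {})"
  by (simp add: ext_map_def bas_nth if_distrib[of "\<lambda>k. k *s _"] cong: if_cong)

lemma SL2_det: "g \<in> SL2 \<Longrightarrow> g $ 1 $ 1 * g $ 2 $ 2 = 1 + g $ 1 $ 2 * g $ 2 $ 1"
  by (simp add: SL2_def det_2 algebra_simps)

lemma matrix_inv_SL2:
  fixes g :: "'k::field ^ 2 ^ 2"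
  assumes "g \<in> SL2"
  shows "matrix_inv g = vector [vector [g $ 2 $ 2, - g $ 1 $ 2], vector [- g $ 2 $ 1, g $ 1 $ 1]]"
    (is "_ = ?h")
proof -
  have 1: "g ** ?h = mat 1" "?h ** g = mat 1"
    using SL2_det[OF assms]
    by (simp_all add: vec_eq_iff forall_2 matrix_matrix_mult_def sum_2 mat_def algebra_simps)
  then have "\<exists>h. g ** h = mat 1 \<and> h ** g = mat 1" by blast
  then have "g ** matrix_inv g = mat 1 \<and> matrix_inv g ** g = mat 1"
    unfolding matrix_inv_def by (rule someI_ex)
  then have "matrix_inv g = matrix_inv g ** (g ** ?h)" "matrix_inv g ** g = mat 1"
    using 1 by simp_all
  then show ?thesis by (simp add: matrix_mul_assoc)
qed

lemma heis_act_bas: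
  "heis_act g (bas Xp) = g $ 1 $ 1 *s bas Xp + g $ 2 $ 1 *s bas Xm"
  "heis_act g (bas Xm) = g $ 1 $ 2 *s bas Xp + g $ 2 $ 2 *s bas Xm"
  "heis_act g (bas H0) = bas H0"
  by (simp_all add: heis_act_def bas_nth)

lemma pairing_bas: "pairing (bas c) v = v $ c"
  by (simp add: pairing_def bas_nth if_distrib[of "\<lambda>k. k * _"] cong: if_cong)

lemma dual_act_bas:
  assumes "g \<in> SL2"
  shows "dual_act g (bas Xp) = g $ 2 $ 2 *s bas Xp - g $ 1 $ 2 *s bas Xm"
    "dual_act g (bas Xm) = g $ 1 $ 1 *s bas Xm - g $ 2 $ 1 *s bas Xp"
    "dual_act g (bas H0) = bas H0"
  by (simp_all add: dual_act_def vec_eq_iff hb_all pairing_bas heis_act_bas matrix_inv_SL2[OF assms] bas_nth)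

text \<open>The top exterior power of the canonical representation is trivial, so the action on the exterior
  algebra only mixes the indices that contain exactly one of \<open>Xp\<close> and \<open>Xm\<close>.\<close>

lemma ext_map_heis:
  assumes "g \<in> SL2"
  shows "ext_map (heis_act g) (bas (hset a b c)) =
    (if a = b then bas (hset a b c)
     else if a then g $ 1 $ 1 *s bas (hset True False c) + g $ 2 $ 1 *s bas (hset False True c)
     else g $ 1 $ 2 *s bas (hset True False c) + g $ 2 $ 2 *s bas (hset False True c))"
  using SL2_det[OF assms]
  by (cases a; cases b; cases c)
    (simp_all add: ext_map_bas sorted_list_hset heis_act_bas ext_incl_bas ext_incl_linear_simps
      wedge_linear_simps wedge_bas hset_folds hset_simps shuffle_sign_hset vec.scale_right_distrib
      vec.scale_right_diff_distrib vec.scale_left_distrib mult.commute)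

lemma ext_map_dual:
  assumes "g \<in> SL2"
  shows "ext_map (dual_act g) (bas (hset a b c)) =
    (if a = b then bas (hset a b c)
     else if a then g $ 2 $ 2 *s bas (hset True False c) - g $ 1 $ 2 *s bas (hset False True c)
     else g $ 1 $ 1 *s bas (hset False True c) - g $ 2 $ 1 *s bas (hset True False c))"
  using SL2_det[OF assms]
  by (cases a; cases b; cases c)
    (simp_all add: ext_map_bas sorted_list_hset dual_act_bas[OF assms] ext_incl_bas ext_incl_linear_simps
      wedge_linear_simps wedge_bas hset_folds hset_simps shuffle_sign_hset vec.scale_right_distrib
      vec.scale_right_diff_distrib vec.scale_left_distrib mult.commute)

lemma act_linear_simps:
  "act g (a + b) = act g a + act g b" "act g (k *s a) = k *s act g a"
  by (simp_all add: act_def case_prod_beta vec.scale_left_distrib sum.distrib vec.scale_sum_right)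

lemma act_diff: "act g (a - b) = act g a - act g b"
  using act_linear_simps(1)[of g a "-1 *s b"] act_linear_simps(2)[of g "-1" b] by simp

lemma act_minus: "act g (- a) = - act g a"
  using act_linear_simps(2)[of g "-1" a] by simp

lemma act_zero [simp]: "act g 0 = 0"
  using act_linear_simps(2)[of g 0 0] by simp

lemma act_bas: "act g (bas (S, T)) = tensor (ext_map (dual_act g) (bas S)) (ext_map (heis_act g) (bas T))"
proof -
  have "act g (bas (S, T)) = (\<Sum>x\<in>UNIV. if x = (S, T) then
     tensor (ext_map (dual_act g) (bas (fst x))) (ext_map (heis_act g) (bas (snd x))) else 0)"
    unfolding act_def by (intro sum.cong refl) (simp add: bas_nth case_prod_beta prod_eq_iff)
  then show ?thesis by simp
qed

lemma tensor_hset: "tensor (bas (hset a b c)) (bas (hset a' b' c')) = mon a b c a' b' c'"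
  by (simp add: mon_def tensor_bas)

text \<open>Here the bracket of \<open>h\<close> being invariant shows up as cancellations that use \<open>det g = 1\<close>.\<close>

lemma ce_diff_act_mon:
  assumes "g \<in> SL2"
  shows "act g (ce_diff (mon a b c a' b' c')) = ce_diff (act g (mon a b c a' b' c'))"
proof -
  note act_mon = act_bas[of g "hset _ _ _" "hset _ _ _", folded mon_def,
      unfolded ext_map_dual[OF assms] ext_map_heis[OF assms]]
  note det = SL2_det[OF assms]
  show ?thesis
    by (cases a; cases b; cases c; cases a'; cases b'; cases c')
      (simp_all add: act_mon det tensor_linear_simps tensor_diff tensor_hset ce_diff_linear_simps ce_diff_expand mon_eval der_diff vee_diff
        act_linear_simps act_diff act_minus vec.scale_right_distrib vec.scale_left_distrib
      vec.scale_right_diff_distrib vec.scale_left_diff_distrib mult.commute algebra_simps)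
qed

lemma ce_diff_act:
  assumes "g \<in> SL2"
  shows "act g (ce_diff a) = ce_diff (act g a)"
proof (rule linear_eq_on_bas[where a = a])
  fix x :: "hb set \<times> hb set"
  obtain S T where "x = (S, T)" by (cases x)
  moreover obtain a b c a' b' c' where "S = hset a b c" "T = hset a' b' c'"
    by (metis hset_cases)
  ultimately show "act g (ce_diff (bas x)) = ce_diff (act g (bas x))"
    using ce_diff_act_mon[OF assms] by (simp add: mon_def)
qed (auto intro!: linearI simp: act_linear_simps ce_diff_linear_simps)

text \<open>The chosen representative differs from \<open>a\<close> by a coboundary, which \<open>g\<close> maps to a coboundary.\<close>

lemma hact_cls:
  assumes "g \<in> SL2" shows "hact g (cls a) = cls (act g a)"
proof -
  obtain c where "rep (cls a) = a + ce_diff c" by (metis rep_cls)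
  then have "act g (rep (cls a)) = act g a + ce_diff (act g c)"
    by (simp add: act_linear_simps ce_diff_act[OF assms])
  then show ?thesis unfolding hact_def cls_eq_iff by blast
qed

section \<open>Equivariant embeddings into the cocycles\<close>

text \<open>An equivariant embedding of the irreducible module into the cocycles that sends the highest weight
  vector to the given cochain.  For two-dimensional modules it uses the equivariant identification
  \<open>(1, 0) \<mapsto> x\<^sub>1\<close>, \<open>(0, 1) \<mapsto> x\<^sub>-\<^sub>1\<close>, or for the dual space \<open>(1, 0) \<mapsto> x\<^sup>1\<close>, \<open>(0, 1) \<mapsto> -x\<^sup>-\<^sup>1\<close>.  A traceless matrix \<open>A\<close>
  becomes the tensor in \<open>span{x\<^sup>-\<^sup>1, x\<^sup>1} \<otimes> span{x\<^sub>1, x\<^sub>-\<^sub>1}\<close> of the endomorphism with matrix \<open>A\<close>.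
  All further factors of the cochains are invariant.\<close>

fun lift :: "comp \<Rightarrow> 'k::field ambient \<Rightarrow> 'k cochain" where
  "lift H0_00 (c, x, A) = c *s tensor (bas {}) (bas {})"
| "lift H0_11 (c, x, A) =
     c *s (tensor dual_x1 vec_xm1 + tensor dual_xm1 vec_x1 + 2 *s tensor dual_h0 vec_h0)"
| "lift H0_22 (c, x, A) = c *s tensor (wedge dual_xm1 dual_x1) (wedge vec_x1 vec_xm1)"
| "lift H0_33 (c, x, A) = c *s tensor (wedge dual_xm1 (wedge dual_x1 dual_h0))
     (wedge vec_x1 (wedge vec_xm1 vec_h0))"
| "lift H1_20 (c, x, A) = tensor (wedge (x $ 1 *s dual_x1 - x $ 2 *s dual_xm1) dual_h0) (bas {})"
| "lift H1_31 (c, x, A) = tensor (wedge dual_xm1 (wedge dual_x1 dual_h0))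
     (x $ 1 *s vec_x1 + x $ 2 *s vec_xm1)"
| "lift H1_02 (c, x, A) = tensor (bas {}) (wedge (x $ 1 *s vec_x1 + x $ 2 *s vec_xm1) vec_h0)"
| "lift H1_13 (c, x, A) = tensor (x $ 1 *s dual_x1 - x $ 2 *s dual_xm1)
     (wedge vec_x1 (wedge vec_xm1 vec_h0))"
| "lift H2_11 (c, x, A) =
     tensor dual_xm1 (A $ 1 $ 1 *s vec_x1 + A $ 2 $ 1 *s vec_xm1)
   + tensor dual_x1 (A $ 1 $ 2 *s vec_x1 + A $ 2 $ 2 *s vec_xm1)"
| "lift H2_22 (c, x, A) =
     tensor (wedge dual_xm1 dual_h0) (wedge (A $ 1 $ 1 *s vec_x1 + A $ 2 $ 1 *s vec_xm1) vec_h0)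
   + tensor (wedge dual_x1 dual_h0) (wedge (A $ 1 $ 2 *s vec_x1 + A $ 2 $ 2 *s vec_xm1) vec_h0)"

lemma lift_mon:
  "lift H0_00 (c, x, A) = c *s mon False False False False False False"
  "lift H0_11 (c, x, A) = c *s mon False True False False True False
     + c *s mon True False False True False False + (2 * c) *s mon False False True False False True"
  "lift H0_22 (c, x, A) = c *s mon True True False True True False"
  "lift H0_33 (c, x, A) = c *s mon True True True True True True"
  "lift H1_20 (c, x, A) =
     x $ 1 *s mon False True True False False False - x $ 2 *s mon True False True False False False"
  "lift H1_31 (c, x, A) =
     x $ 1 *s mon True True True True False False + x $ 2 *s mon True True True False True False"
  "lift H1_02 (c, x, A) =
     x $ 1 *s mon False False False True False True + x $ 2 *s mon False False False False True True"
  "lift H1_13 (c, x, A) =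
     x $ 1 *s mon False True False True True True - x $ 2 *s mon True False False True True True"
  "lift H2_11 (c, x, A) =
     A $ 1 $ 1 *s mon True False False True False False + A $ 2 $ 1 *s mon True False False False True False
   + A $ 1 $ 2 *s mon False True False True False False + A $ 2 $ 2 *s mon False True False False True False"
  "lift H2_22 (c, x, A) =
     A $ 1 $ 1 *s mon True False True True False True + A $ 2 $ 1 *s mon True False True False True True
   + A $ 1 $ 2 *s mon False True True True False True + A $ 2 $ 2 *s mon False True True False True True"
  by (simp_all add: ext_incl_bas wedge_bas wedge_linear_simps hset_folds hset_simps
      shuffle_sign_hset tensor_linear_simps tensor_diff tensor_hset vec.scale_right_distrib
      mult.commute)

lemma numeral_times_vec: "numeral n * v = numeral n *s v"
  for v :: "('k::field, 'n::finite) vec"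
  by (simp add: vec_eq_iff)

lemma lift_hw: "lift r (hw (wt r)) = hwv r"
  by (cases r) (simp_all add: ext_incl_bas tensor_linear_simps wedge_zero)

lemma trace_2: "trace A = A $ 1 $ 1 + A $ 2 $ 2" for A :: "'k::field ^ 2 ^ 2"
  by (simp add: trace_def sum_2)

lemma Vmod_trace: "(c, x, A) \<in> Vmod I2 \<Longrightarrow> A $ 2 $ 2 = - A $ 1 $ 1"
  by (auto simp: trace_2 add_eq_0_iff)

lemma lift_add: "lift r (v + w) = lift r v + lift r w"
proof (cases v; cases w)
  fix c x A d y B assume "v = (c, x, A)" "w = (d, y, B)"
  then show ?thesis
    by (cases r) (simp_all add: lift_mon distrib_left vec.scale_left_distrib del: lift.simps)
qed

lemma lift_scale: "lift r (vscale k v) = k *s lift r v"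
  by (cases r; cases v)
    (simp_all add: lift_mon vec.scale_right_distrib vec.scale_right_diff_distrib mult_ac del: lift.simps)

lemma lift_cocycle:
  assumes "v \<in> Vmod (wt r)"
  shows "ce_diff (lift r v) = 0"
proof -
  obtain c x A where v: "v = (c, x, A)" by (cases v)
  have "A $ 2 $ 2 = - A $ 1 $ 1" if "wt r = I2"
    using assms that v Vmod_trace by metis
  then show ?thesis
    by (cases r) (simp_all add: v lift_mon ce_diff_linear_simps ce_diff_expand mon_eval der_diff
      vee_diff vec.scale_right_distrib numeral_times_vec del: lift.simps)
qed

lemma cochains_diff: "a \<in> cochains p q \<Longrightarrow> b \<in> cochains p q \<Longrightarrow> a - b \<in> cochains p q"
  using cochains_add[of a p q "-1 *s b"] cochains_scale[of b p q "-1"] by simp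

lemma mon_cochains:
  "of_bool a + of_bool b + of_bool c = p \<Longrightarrow> of_bool a' + of_bool b' + of_bool c' = q \<Longrightarrow>
    mon a b c a' b' c' \<in> cochains p q"
  unfolding mon_def by (rule bas_cochains) (simp_all add: card_hset)

lemma lift_cochains: "lift r v \<in> cochains (pdeg r) (qdeg r)"
  by (cases r; cases v)
    (simp_all add: lift_mon cochains_add cochains_diff cochains_scale mon_cochains del: lift.simps)

lemma lift_act:
  assumes "g \<in> SL2"
  shows "act g (lift r v) = lift r (vact g v)"
proof -
  note act_mon = act_bas[of g "hset _ _ _" "hset _ _ _", folded mon_def,
      unfolded ext_map_dual[OF assms] ext_map_heis[OF assms]]
  note det = SL2_det[OF assms]
  show ?thesis
    by (cases r; cases v)
      (simp_all add: lift_mon act_mon det tensor_linear_simps tensor_diff tensor_hset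
        act_linear_simps act_diff act_minus vec.scale_right_distrib vec.scale_left_distrib
        matrix_inv_SL2[OF assms] matrix_vector_mult_def matrix_matrix_mult_def sum_2
        vec.scale_right_diff_distrib vec.scale_left_diff_distrib mult.commute algebra_simps
        del: lift.simps)
qed

lemma vee_bas_nth:
  "vee (bas p) a $ z = (if p \<le> z then koszul p (z - p) * a $ (z - p) else 0)"
proof -
  have "vee (bas p) a = (\<chi> z. if p \<le> z then koszul p (z - p) * a $ (z - p) else 0)"
  proof (rule linear_eq_on_bas[where a = a])
    fix x
    have "vee (bas p) (bas x) $ z = (if p \<le> z then koszul p (z - p) * bas x $ (z - p) else 0)" for z
    proof (cases "p \<le> z \<and> x = z - p")
      case True
      then show ?thesis
        using pair_diff_disjoint[of p z] pair_sup_diff[of p z] by (auto simp: vee_bas bas_nth)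
    next
      case False
      have "sup p x - p = x" if "inf p x = bot"
        using that by (cases p; cases x) (auto simp: bot_prod_def)
      with False have "inf p x = bot \<Longrightarrow> z \<noteq> sup p x" by auto
      with False show ?thesis by (auto simp: vee_bas bas_nth)
    qed
    then show "vee (bas p) (bas x) = (\<chi> z. if p \<le> z then koszul p (z - p) * bas x $ (z - p) else 0)"
      by (subst vec_eq_iff) (simp only: vec_lambda_beta, blast)
  qed (auto intro!: linearI simp: vee_add_right vee_scale_right vec_eq_iff algebra_simps)
  then show ?thesis by simp
qed

lemma der_nth:
  "der p a $ z = (if inf p z = bot then koszul p z * a $ (sup p z) else 0)"
proof -
  have "der p a = (\<chi> z. if inf p z = bot then koszul p z * a $ (sup p z) else 0)"
  proof (rule linear_eq_on_bas[where a = a])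
    fix x
    have "der p (bas x) $ z = (if inf p z = bot then koszul p z * bas x $ (sup p z) else 0)" for z
    proof (cases "p \<le> x \<and> z = x - p")
      case True
      then show ?thesis
        using pair_diff_disjoint[of p x] pair_sup_diff[of p x] by (auto simp: der_bas bas_nth)
    next
      case False
      have "sup p z - p = z" if "inf p z = bot"
        using that by (cases p; cases z) (auto simp: bot_prod_def)
      with False have "inf p z = bot \<Longrightarrow> sup p z \<noteq> x" by auto
      with False show ?thesis by (auto simp: der_bas bas_nth)
    qed
    then show "der p (bas x) = (\<chi> z. if inf p z = bot then koszul p z * bas x $ (sup p z) else 0)"
      by (subst vec_eq_iff) (simp only: vec_lambda_beta, blast)
  qed (auto intro!: linearI simp: der_linear_simps vec_eq_iff algebra_simps)
  then show ?thesis by simp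
qed

lemma vee_mon_nth: "vee (mon a b c a' b' c') e $ (hset p q r, hset p' q' r') =
   (if (a \<longrightarrow> p) \<and> (b \<longrightarrow> q) \<and> (c \<longrightarrow> r) \<and> (a' \<longrightarrow> p') \<and> (b' \<longrightarrow> q') \<and> (c' \<longrightarrow> r')
    then koszul (hset a b c, hset a' b' c')
        (hset (p \<and> \<not> a) (q \<and> \<not> b) (r \<and> \<not> c), hset (p' \<and> \<not> a') (q' \<and> \<not> b') (r' \<and> \<not> c')) *
      e $ (hset (p \<and> \<not> a) (q \<and> \<not> b) (r \<and> \<not> c), hset (p' \<and> \<not> a') (q' \<and> \<not> b') (r' \<and> \<not> c')) else 0)"
  by (simp add: mon_def vee_bas_nth hset_simps)

lemma der_hset_nth: "der (hset a b c, hset a' b' c') e $ (hset p q r, hset p' q' r') =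
   (if a \<and> p \<or> b \<and> q \<or> c \<and> r \<or> a' \<and> p' \<or> b' \<and> q' \<or> c' \<and> r' then 0
    else koszul (hset a b c, hset a' b' c') (hset p q r, hset p' q' r') *
      e $ (hset (a \<or> p) (b \<or> q) (c \<or> r), hset (a' \<or> p') (b' \<or> q') (c' \<or> r')))"
proof -
  have "inf (hset a b c, hset a' b' c') (hset p q r, hset p' q' r') = bot
      \<longleftrightarrow> \<not> (a \<and> p \<or> b \<and> q \<or> c \<and> r \<or> a' \<and> p' \<or> b' \<and> q' \<or> c' \<and> r')"
    by (simp add: bot_prod_def hset_simps hset_folds(1))
  then show ?thesis by (simp add: der_nth hset_simps)
qed

text \<open>Compare the coordinates at the basis vectors that occur in \<open>lift r v\<close>.  At most of them every
  coboundary vanishes.  The exception is bidegree \<open>(2, 2)\<close>, where \<open>\<beta> \<cdot> d(h\<^sup>0 \<otimes> x\<^sub>1 x\<^sub>-\<^sub>1)\<close> contributes \<open>\<beta>\<close> to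
  one coordinate and \<open>-\<beta>\<close> to two others: for the trivial module these others are zero in
  \<open>lift r v\<close>, and for the adjoint module both diagonal entries of the matrix would be \<open>-\<beta>\<close>, which
  contradicts trace zero unless \<open>\<beta> = 0\<close>, as \<open>2\<close> is invertible.\<close>

lemma lift_exact_zero:
  fixes v :: "'k::field_char_0 ambient"
  assumes v: "v \<in> Vmod (wt r)" and exact: "lift r v = ce_diff b"
  shows "v = 0"
proof -
  have nth: "lift r v $ (hset p q s, hset p' q' s') = ce_diff b $ (hset p q s, hset p' q' s')" for p q s p' q' s'
    by (simp add: exact)
  obtain c x A where vc: "v = (c, x, A)" by (cases v)
  note ev = lift_mon mon_nth ce_diff_expand vee_mon_nth der_hset_nth koszul_hset hset_simps
  note mem = zero_prod_def vec_eq_iff forall_2 trace_2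
  show ?thesis
  proof (cases r)
    case H0_00
    then show ?thesis
      using v nth[of False False False False False False]
      by (auto simp: ev mem vc add_eq_0_iff simp del: lift.simps)
  next
    case H0_11
    then show ?thesis
      using v nth[of False True False False True False]
      by (auto simp: ev mem vc add_eq_0_iff simp del: lift.simps)
  next
    case H2_11
    then show ?thesis
      using v nth[of True False False True False False]
        nth[of True False False False True False]
        nth[of False True False True False False]
        nth[of False True False False True False]
      by (auto simp: ev mem vc add_eq_0_iff simp del: lift.simps)
  next
    case H1_20
    then show ?thesis
      using v nth[of False True True False False False]
        nth[of True False True False False False]
      by (auto simp: ev mem vc add_eq_0_iff simp del: lift.simps)
  next
    case H1_02
    then show ?thesis
      using v nth[of False False False True False True]
        nth[of False False False False True True]
      by (auto simp: ev mem vc add_eq_0_iff simp del: lift.simps)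
  next
    case H0_22
    then show ?thesis
      using v nth[of True True False True True False]
        nth[of False True True False True True]
      by (auto simp: ev mem vc add_eq_0_iff simp del: lift.simps)
  next
    case H2_22
    then show ?thesis
      using v nth[of True False True True False True]
        nth[of True False True False True True]
        nth[of False True True True False True]
        nth[of False True True False True True]
      by (auto simp: ev mem vc add_eq_0_iff simp del: lift.simps)
  next
    case H1_31
    then show ?thesis
      using v nth[of True True True True False False]
        nth[of True True True False True False]
      by (auto simp: ev mem vc add_eq_0_iff simp del: lift.simps)
  next
    case H1_13
    then show ?thesis
      using v nth[of False True False True True True]
        nth[of True False False True True True]
      by (auto simp: ev mem vc add_eq_0_iff simp del: lift.simps)
  next
    case H0_33
    then show ?thesis
      using v nth[of True True True True True True]
      by (auto simp: ev mem vc add_eq_0_iff simp del: lift.simps)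
  qed
qed

section \<open>The components and their parametrizations\<close>

lemma Vmod_iff:
  "(c, x, A) \<in> Vmod I0 \<longleftrightarrow> x = 0 \<and> A = 0"
  "(c, x, A) \<in> Vmod I1 \<longleftrightarrow> c = 0 \<and> A = 0"
  "(c, x, A) \<in> Vmod I2 \<longleftrightarrow> c = 0 \<and> x = 0 \<and> A $ 2 $ 2 = - A $ 1 $ 1"
  by (auto simp: trace_2 add_eq_0_iff)

lemma Vmod_add: "v \<in> Vmod k \<Longrightarrow> w \<in> Vmod k \<Longrightarrow> v + w \<in> Vmod k"
  by (cases k; cases v; cases w) (simp_all add: Vmod_iff del: Vmod.simps)

lemma Vmod_scale: "v \<in> Vmod k \<Longrightarrow> vscale c v \<in> Vmod k"
  by (cases k; cases v) (simp_all add: Vmod_iff vec_eq_iff del: Vmod.simps)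

lemmas Vmod_closed = Vmod_add Vmod_scale

lemma Vmod_act: "g \<in> SL2 \<Longrightarrow> v \<in> Vmod k \<Longrightarrow> vact g v \<in> Vmod k"
proof (cases k)
  fix g :: "'a ^ 2 ^ 2" assume g: "g \<in> SL2" and v: "v \<in> Vmod k" and "k = I2"
  then obtain A where A: "v = (0, 0, A)" "A $ 2 $ 2 = - A $ 1 $ 1"
    by (auto simp: trace_2 add_eq_0_iff)
  have "trace (g ** A ** matrix_inv g) = 0"
    by (simp add: trace_2 matrix_inv_SL2[OF g] matrix_matrix_mult_def sum_2 A algebra_simps)
  with A \<open>k = I2\<close> show "vact g v \<in> Vmod k" by simp
qed auto

lemma hw_Vmod: "hw k \<in> Vmod k"
  by (cases k) (simp_all add: trace_2)

text \<open>The module is spanned by translates of its highest weight vector \<open>hw\<close> under the identity and two more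
  elements of the group.  This serves twice: no smaller submodule of cohomology contains the class of
  the highest weight vector, and an equivariant linear map is determined by its value there.\<close>

lemma Vmod_generated:
  fixes v :: "'k::field ambient"
  assumes v: "v \<in> Vmod k"
    and hw: "P (hw k)"
    and add: "\<And>v w. v \<in> Vmod k \<Longrightarrow> w \<in> Vmod k \<Longrightarrow> P v \<Longrightarrow> P w \<Longrightarrow> P (v + w)"
    and scale: "\<And>c v. v \<in> Vmod k \<Longrightarrow> P v \<Longrightarrow> P (vscale c v)"
    and act: "\<And>g v. g \<in> SL2 \<Longrightarrow> v \<in> Vmod k \<Longrightarrow> P v \<Longrightarrow> P (vact g v)"
  shows "P v"
proof -
  define J :: "'k ^ 2 ^ 2" where "J = vector [vector [0, -1], vector [1, 0]]"
  define U :: "'k ^ 2 ^ 2" where "U = vector [vector [1, 0], vector [1, 1]]"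
  have SL: "J \<in> SL2" "U \<in> SL2" by (simp_all add: J_def U_def SL2_def det_2)
  note closed = Vmod_closed Vmod_act hw_Vmod SL
  \<comment> \<open>For the adjoint module, the translates of \<open>E\<close> are \<open>E\<close>, \<open>-F\<close> and \<open>E - H - F\<close>.\<close>
  have comb: "P (vscale a (hw k) + (vscale b (vact J (hw k)) + vscale c (vact U (hw k))))" for a b c
    by (intro add scale act hw closed)
  have ex: "\<exists>a b c. v = vscale a (hw k) + (vscale b (vact J (hw k)) + vscale c (vact U (hw k)))"
  proof (cases k)
    case I0
    then obtain a where "v = (a, 0, 0)" using v by auto
    then have "v = vscale a (hw k) + (vscale 0 (vact J (hw k)) + vscale 0 (vact U (hw k)))"
      using I0 by (simp add: vec_eq_iff forall_2 matrix_vector_mult_def matrix_matrix_mult_def sum_2)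
    then show ?thesis by blast
  next
    case I1
    then obtain x where "v = (0, x, 0)" using v by auto
    then have "v = vscale (x $ 1) (hw k) + (vscale (x $ 2) (vact J (hw k)) + vscale 0 (vact U (hw k)))"
      using I1 by (simp add: vec_eq_iff forall_2 matrix_vector_mult_def matrix_matrix_mult_def sum_2 J_def)
    then show ?thesis by blast
  next
    case I2
    then obtain A where "v = (0, 0, A)" "A $ 2 $ 2 = - A $ 1 $ 1"
      using v by (auto simp: trace_2 add_eq_0_iff)
    then have "v = vscale (A $ 1 $ 1 + A $ 1 $ 2) (hw k) + (vscale (A $ 1 $ 1 - A $ 2 $ 1) (vact J (hw k))
        + vscale (- A $ 1 $ 1) (vact U (hw k)))"
      using I2 by (simp add: vec_eq_iff forall_2 matrix_vector_mult_def matrix_matrix_mult_def sum_2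
          matrix_inv_SL2 SL) (simp add: J_def U_def)
    then show ?thesis by blast
  qed
  then show ?thesis using comb by blast
qed

lemma cls_lift_closed:
  "hadd (cls (lift r v)) (cls (lift r w)) = cls (lift r (v + w))"
  "hscale c (cls (lift r v)) = cls (lift r (vscale c v))"
  "g \<in> SL2 \<Longrightarrow> hact g (cls (lift r v)) = cls (lift r (vact g v))"
  by (simp_all add: hadd_cls hscale_cls hact_cls lift_add lift_scale lift_act)

lemma lift_cohomology: "v \<in> Vmod (wt r) \<Longrightarrow> cls (lift r v) \<in> cohomology (pdeg r) (qdeg r)"
  unfolding cohomology_def using lift_cochains lift_cocycle by blast

lemma lift_zero: "lift r 0 = 0"
  using lift_scale[of r 0 0] by (cases r) (simp_all add: zero_prod_def vec_eq_iff)

lemma zero_Vmod: "0 \<in> Vmod k"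
  by (cases k) (auto simp: zero_prod_def trace_2)

text \<open>The image is a submodule because the embedding is equivariant, and every submodule that contains the
  class of the highest weight vector contains the image because that vector generates.\<close>

lemma Hcomp_eq: "Hcomp r = ((\<lambda>v. cls (lift r v)) ` Vmod (wt r) :: 'k::field coho set)"
proof
  let ?I = "(\<lambda>v. cls (lift r v)) ` Vmod (wt r) :: 'k coho set"
  have "hsubmodule ?I"
    unfolding hsubmodule_def
  proof (intro conjI ballI allI)
    show "cls 0 \<in> ?I"
      using lift_zero[of r] zero_Vmod by (metis image_eqI)
  next
    fix A B :: "'k coho" assume "A \<in> ?I" "B \<in> ?I"
    then obtain v w where vw: "A = cls (lift r v)" "B = cls (lift r w)" "v \<in> Vmod (wt r)" "w \<in> Vmod (wt r)"
      by blast
    show "hadd A B \<in> ?I"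
      unfolding vw cls_lift_closed by (intro imageI Vmod_closed vw)
  next
    fix c and A :: "'k coho" assume "A \<in> ?I"
    then obtain v where v: "A = cls (lift r v)" "v \<in> Vmod (wt r)"
      by blast
    show "hscale c A \<in> ?I"
      unfolding v cls_lift_closed by (intro imageI Vmod_closed v)
  next
    fix g :: "'k ^ 2 ^ 2" and A :: "'k coho" assume g: "g \<in> SL2" and "A \<in> ?I"
    then obtain v where v: "A = cls (lift r v)" "v \<in> Vmod (wt r)"
      by blast
    show "hact g A \<in> ?I"
      unfolding v cls_lift_closed(3)[OF g] by (intro imageI Vmod_act v g)
  qed
  moreover have "cls (hwv r) \<in> ?I"
    using lift_hw[of r] hw_Vmod by (metis image_eqI)
  ultimately show "Hcomp r \<subseteq> ?I"
    unfolding Hcomp_def using lift_cohomology by (intro Inter_lower) auto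
next
  show "((\<lambda>v. cls (lift r v)) ` Vmod (wt r) :: 'k coho set) \<subseteq> Hcomp r"
    unfolding Hcomp_def
  proof (intro Inter_greatest subsetI, clarify)
    fix W :: "'k coho set" and v :: "'k ambient"
    assume W: "hsubmodule W" "cls (hwv r) \<in> W" and v: "v \<in> Vmod (wt r)"
    show "cls (lift r v) \<in> W"
      by (rule Vmod_generated[OF v])
        (use W in \<open>auto simp: hsubmodule_def lift_hw simp flip: cls_lift_closed\<close>)
  qed
qed

lemma cls_lift_inj:
  "inj_on (\<lambda>v. cls (lift r v)) (Vmod (wt r) :: 'k::field_char_0 ambient set)"
proof (rule inj_onI)
  fix v w :: "'k ambient"
  assume vw: "v \<in> Vmod (wt r)" "w \<in> Vmod (wt r)" and "cls (lift r v) = cls (lift r w)"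
  then obtain e where "lift r v = lift r w + ce_diff e" by (auto simp: cls_eq_iff)
  then have "lift r (v + vscale (-1) w) = ce_diff e"
    by (simp add: lift_add lift_scale del: vscale.simps)
  then have "v + vscale (-1) w = 0"
    using lift_exact_zero[of "v + vscale (-1) w"] vw Vmod_closed by blast
  then show "v = w"
    by (cases v; cases w) (simp add: zero_prod_def vec_eq_iff)
qed

lemma is_tau_lift:
  "is_tau r (restrict (\<lambda>v. cls (lift r v)) (Vmod (wt r) :: 'k::field_char_0 ambient set))"
  unfolding is_tau_def bij_betw_def Hcomp_eq
  using cls_lift_inj[of r]
  by (auto simp: inj_on_restrict_eq Vmod_closed Vmod_act hw_Vmod cls_lift_closed lift_hw
      simp del: vscale.simps vact.simps)

lemma tau_eq:
  fixes v :: "'k::field_char_0 ambient"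
  assumes "v \<in> Vmod (wt r)"
  shows "tau r v = cls (lift r v)"
proof -
  let ?f = "restrict (\<lambda>v. cls (lift r v)) (Vmod (wt r) :: 'k ambient set)"
  have "tau r = ?f"
    unfolding tau_def
  proof (rule the_equality)
    show "?f \<in> extensional (Vmod (wt r)) \<and> is_tau r ?f"
      using is_tau_lift by simp
  next
    fix f :: "'k ambient \<Rightarrow> 'k coho"
    assume f: "f \<in> extensional (Vmod (wt r)) \<and> is_tau r f"
    have "f v = cls (lift r v)" if "v \<in> Vmod (wt r)" for v
      by (rule Vmod_generated[OF that])
        (use f in \<open>auto simp: is_tau_def lift_hw cls_lift_closed simp del: vscale.simps vact.simps\<close>)
    then show "f = ?f"
      using f by (intro extensionalityI[where A = "Vmod (wt r)"]) auto
  qed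
  then show ?thesis using assms by simp
qed

lemma mmap_Vmod: "v \<in> Vmod i \<Longrightarrow> w \<in> Vmod j \<Longrightarrow> mmap i j k v w \<in> Vmod k"
  by (cases v; cases w; cases i; cases j; cases k)
    (simp_all add: Vmod_iff zero_prod_def matrix_matrix_mult_def sum_2 vec_eq_iff algebra_simps
      del: Vmod.simps)

section \<open>The table\<close>

text \<open>Four brackets of embedded modules, with values in bidegree \<open>(2, 2)\<close>, agree with the table only after
  a coboundary is subtracted, namely a multiple of \<open>d(h\<^sup>0 \<otimes> x\<^sub>1 x\<^sub>-\<^sub>1)\<close>.  This coboundary is invariant, so by equivariance
  the factor is proportional to the invariant pairing of the two arguments.\<close>

fun correction :: "comp \<Rightarrow> comp \<Rightarrow> 'k::field ambient \<Rightarrow> 'k ambient \<Rightarrow> 'k cochain" where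
  "correction H1_20 H1_13 (_, x, _) (_, y, _) =
     ((x $ 1 * y $ 2 - x $ 2 * y $ 1) / 2) *s tensor dual_h0 (wedge vec_x1 vec_xm1)"
| "correction H1_13 H1_20 (_, x, _) (_, y, _) =
     ((x $ 1 * y $ 2 - x $ 2 * y $ 1) / 2) *s tensor dual_h0 (wedge vec_x1 vec_xm1)"
| "correction H1_02 H1_31 (_, x, _) (_, y, _) =
     (- (x $ 1 * y $ 2 - x $ 2 * y $ 1) / 2) *s tensor dual_h0 (wedge vec_x1 vec_xm1)"
| "correction H1_31 H1_02 (_, x, _) (_, y, _) =
     (- (x $ 1 * y $ 2 - x $ 2 * y $ 1) / 2) *s tensor dual_h0 (wedge vec_x1 vec_xm1)"
| "correction _ _ _ _ = 0"

lemmas poisson_mon = poisson_expand[of "mon _ _ _ _ _ _" "mon _ _ _ _ _ _"]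

lemma correction_tensor: "tensor dual_h0 (wedge vec_x1 vec_xm1) = mon False False True True True False"
  by (simp add: ext_incl_bas hset_folds wedge_bas hset_simps shuffle_sign_hset tensor_hset)

text \<open>Both sides are bilinear in the components of \<open>v\<close> and \<open>w\<close>, so each entry of the table is a finite
  computation with brackets of monomials.\<close>

lemma poisson_lift:
  fixes v w :: "'k::field_char_0 ambient"
  assumes "v \<in> Vmod (wt r)" "w \<in> Vmod (wt s)"
  shows "poisson (lift r v) (lift s w) =
    (\<Sum>(c, t)\<leftarrow>table r s. c *s lift t (mmap (wt r) (wt s) (wt t) v w)) + ce_diff (correction r s v w)"
proof -
  obtain c x A d y B where vw: "v = (c, x, A)" "w = (d, y, B)"
    by (cases v; cases w)
  have tr: "A $ 2 $ 2 = - A $ 1 $ 1" if "wt r = I2"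
    using assms that vw Vmod_trace by metis
  have tr': "B $ 2 $ 2 = - B $ 1 $ 1" if "wt s = I2"
    using assms that vw Vmod_trace by metis
  note ev = vw tr tr' lift_mon poisson_linear_simps poisson_diff poisson_mon mon_eval der_diff vee_diff
    ce_diff_linear_simps ce_diff_expand correction_tensor
    matrix_matrix_mult_def vector_matrix_mult_def transpose_def sum_2
    vec.scale_right_distrib vec.scale_left_distrib
    vec.scale_right_diff_distrib vec.scale_left_diff_distrib numeral_times_vec algebra_simps
  show ?thesis
  proof (cases r)
    case H0_00 then show ?thesis by (cases s) (simp_all add: ev del: lift.simps)
  next
    case H0_11 then show ?thesis
      by (cases s) (simp_all add: ev del: lift.simps, simp_all add: vec_eq_iff field_simps)
  next
    case H2_11 then show ?thesis by (cases s) (simp_all add: ev del: lift.simps)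
  next
    case H1_20 then show ?thesis
      by (cases s) (simp_all add: ev del: lift.simps, simp_all add: vec_eq_iff field_simps)
  next
    case H1_02 then show ?thesis
      by (cases s) (simp_all add: ev del: lift.simps, simp_all add: vec_eq_iff field_simps)
  next
    case H0_22 then show ?thesis by (cases s) (simp_all add: ev del: lift.simps)
  next
    case H2_22 then show ?thesis by (cases s) (simp_all add: ev del: lift.simps)
  next
    case H1_31 then show ?thesis
      by (cases s) (simp_all add: ev del: lift.simps, simp_all add: vec_eq_iff field_simps)
  next
    case H1_13 then show ?thesis
      by (cases s) (simp_all add: ev del: lift.simps, simp_all add: vec_eq_iff field_simps)
  next
    case H0_33 then show ?thesis by (cases s) (simp_all add: ev del: lift.simps)
  qed
qed

lemma hsum_tau:
  fixes v w :: "'k::field_char_0 ambient"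
  assumes "v \<in> Vmod i" "w \<in> Vmod j"
  shows "hsum (map (\<lambda>(c, t). hscale c (tau t (mmap i j (wt t) v w))) ts)
    = cls (\<Sum>(c, t)\<leftarrow>ts. c *s lift t (mmap i j (wt t) v w))"
proof (induction ts)
  case (Cons a ts)
  then show ?case
    by (cases a) (simp add: hsum_def tau_eq mmap_Vmod[OF assms] hscale_cls hadd_cls)
qed (simp add: hsum_def)

theorem theorem3p3:
  fixes r s :: comp and v w :: "'k::field_char_0 ambient"
  assumes "v \<in> Vmod (wt r)" and "w \<in> Vmod (wt s)"
  shows "hbracket (tau r v) (tau s w) =
    hsum (map (\<lambda>(c, t). hscale c (tau t (mmap (wt r) (wt s) (wt t) v w))) (table r s))"
proof -
  have "hbracket (tau r v) (tau s w) = cls (poisson (lift r v) (lift s w))"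
    using assms by (simp add: tau_eq hbracket_cls lift_cocycle)
  also have "\<dots> = cls (\<Sum>(c, t)\<leftarrow>table r s. c *s lift t (mmap (wt r) (wt s) (wt t) v w))"
    unfolding cls_eq_iff using poisson_lift[OF assms] by blast
  finally show ?thesis by (simp add: hsum_tau[OF assms])
qed

end
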